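(* Let $\Sigma$ be a closed connected orientable surface. For any $\epsilon>0$ there exist a magnetic Lagrangian $L_\epsilon:T\Sigma\to\mathbb R$, with $c_u(L_\epsilon)\in[\frac12-\epsilon,\frac12]$, and closed connected submanifolds $Q_0,Q_1\subseteq\Sigma$ with $Q_0\cap Q_1\ne\emptyset$ such that for all $k<\frac12-\epsilon$ the energy level $E^{-1}(k)$ carries no Euler-Lagrange orbits satisfying the conormal boundary conditions.
   Context: A magnetic Lagrangian on $\Sigma$ is a function $L(q,v)=\frac12\|v\|_q^2+\theta_q(v)$, where $\|\cdot\|$ is the norm of a Riemannian metric on $\Sigma$ and $\theta$ is a smooth 1-form on $\Sigma$. Its energy is $E(q,v)=\frac12\|v\|_q^2$. The Mañé critical value of the universal cover is $$c_u(L)=\inf\Big\{k\in\mathbb R\ \Big|\ \int_0^T[L(\gamma,\dot\gamma)+k]\,dt\ge0\ \text{ for every closed contractible loop }\gamma:[0,T]\to\Sigma,\ T>0\Big\}.$$ An Euler-Lagrange orbit in $E^{-1}(k)$ satisfying the conormal boundary conditions (for $Q_0,Q_1$) is a solution $\gamma:[0,T]\to\Sigma$ ($T>0$) of the Euler-Lagrange equation of $L$ with $E(\gamma,\dot\gamma)\equiv k$, $\gamma(0)\in Q_0$, $\gamma(T)\in Q_1$, such that the fiberwise differential $d_vL(\gamma(0),\dot\gamma(0))$ vanishes on $T_{\gamma(0)}Q_0$ and $d_vL(\gamma(T),\dot\gamma(T))$ vanishes on $T_{\gamma(T)}Q_1$. *)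

theory Defs
  imports "HOL-Analysis.Analysis"
begin

section \<open>Smooth maps on open subsets of Euclidean spaces\<close>

primrec Ck_on ::
  "nat \<Rightarrow> 'a::euclidean_space set \<Rightarrow> ('a \<Rightarrow> 'b::euclidean_space) \<Rightarrow> bool" where
  "Ck_on 0 U f \<longleftrightarrow> continuous_on U f"
| "Ck_on (Suc n) U f \<longleftrightarrow>
     (\<forall>x\<in>U. f differentiable (at x)) \<and> (\<forall>v. Ck_on n U (\<lambda>x. frechet_derivative f (at x) v))"

text \<open>Only meaningful for open \<open>U\<close>, since two-sided derivatives are used.\<close>

definition smooth_on :: "'a::euclidean_space set \<Rightarrow> ('a \<Rightarrow> 'b::euclidean_space) \<Rightarrow> bool" where
  "smooth_on U f \<longleftrightarrow> (\<forall>n. Ck_on n U f)"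


section \<open>Surfaces\<close>

text \<open>A chart is a domain together with a coordinate map; the values of the coordinate map
  outside the domain are irrelevant.\<close>

type_synonym 'a chart = "'a set \<times> ('a \<Rightarrow> real^2)"

definition chart_inv :: "'a chart \<Rightarrow> real^2 \<Rightarrow> 'a" where
  "chart_inv c = inv_into (fst c) (snd c)"

definition transition :: "'a chart \<Rightarrow> 'a chart \<Rightarrow> real^2 \<Rightarrow> real^2" where
  "transition c d = snd d \<circ> chart_inv c"

definition is_chart :: "'a::topological_space set \<Rightarrow> 'a chart \<Rightarrow> bool" where
  "is_chart S c \<longleftrightarrow>
     openin (top_of_set S) (fst c) \<and> open (snd c ` fst c) \<and>
     homeomorphism (fst c) (snd c ` fst c) (snd c) (chart_inv c)"

definition smooth_atlas :: "'a::topological_space set \<Rightarrow> 'a chart set \<Rightarrow> bool" where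
  "smooth_atlas S A \<longleftrightarrow>
     (\<forall>c\<in>A. is_chart S c) \<and> S = (\<Union>c\<in>A. fst c) \<and>
     (\<forall>c\<in>A. \<forall>d\<in>A. smooth_on (snd c ` (fst c \<inter> fst d)) (transition c d))"

text \<open>Second countability is implied by compactness. An atlas need not be maximal.\<close>

definition closed_connected_surface :: "'a::t2_space set \<Rightarrow> 'a chart set \<Rightarrow> bool" where
  "closed_connected_surface S A \<longleftrightarrow>
     smooth_atlas S A \<and> compact S \<and> connected S \<and> S \<noteq> {}"

definition orientable :: "'a::topological_space set \<Rightarrow> 'a chart set \<Rightarrow> bool" where
  "orientable S A \<longleftrightarrow>
     (\<exists>B. smooth_atlas S B \<and> smooth_atlas S (A \<union> B) \<and>
        (\<forall>c\<in>B. \<forall>d\<in>B. \<forall>x \<in> snd c ` (fst c \<inter> fst d).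
           det (matrix (frechet_derivative (transition c d) (at x))) > 0))"


section \<open>Tangent vectors, metrics and one-forms\<close>

text \<open>A tangent vector at \<open>p\<close> is the family of its coordinate vectors in the charts of the atlas
  around \<open>p\<close>, related by the Jacobians of the transition maps. The value \<open>0\<close> at all other charts
  is a normalization that makes the representation unique.\<close>

type_synonym 'a tvec = "'a chart \<Rightarrow> real^2"

definition tangent_space :: "'a chart set \<Rightarrow> 'a \<Rightarrow> 'a tvec set" where
  "tangent_space A p = {X.
     (\<forall>c. \<not> (c \<in> A \<and> p \<in> fst c) \<longrightarrow> X c = 0) \<and>
     (\<forall>c\<in>A. \<forall>d\<in>A. p \<in> fst c \<inter> fst d \<longrightarrow>
        X d = frechet_derivative (transition c d) (at (snd c p)) (X c))}"

text \<open>The tangent vector at \<open>p\<close> with coordinate vector \<open>w\<close> in the chart \<open>c\<close>.\<close>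

definition tvec_of :: "'a chart set \<Rightarrow> 'a chart \<Rightarrow> 'a \<Rightarrow> real^2 \<Rightarrow> 'a tvec" where
  "tvec_of A c p w = (\<lambda>d. if d \<in> A \<and> p \<in> fst d
     then frechet_derivative (transition c d) (at (snd c p)) w else 0)"

text \<open>\<open>tv_comb X s Y\<close> is \<open>X + s Y\<close>.\<close>

definition tv_comb :: "'a tvec \<Rightarrow> real \<Rightarrow> 'a tvec \<Rightarrow> 'a tvec" where
  "tv_comb X s Y = (\<lambda>c. X c + s *\<^sub>R Y c)"

definition linear_at :: "'a chart set \<Rightarrow> 'a \<Rightarrow> ('a tvec \<Rightarrow> real) \<Rightarrow> bool" where
  "linear_at A p f \<longleftrightarrow>
     (\<forall>X\<in>tangent_space A p. \<forall>Y\<in>tangent_space A p. \<forall>s. f (tv_comb X s Y) = f X + s * f Y)"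

definition riemannian_metric ::
  "'a set \<Rightarrow> 'a chart set \<Rightarrow> ('a \<Rightarrow> 'a tvec \<Rightarrow> 'a tvec \<Rightarrow> real) \<Rightarrow> bool" where
  "riemannian_metric S A g \<longleftrightarrow>
     (\<forall>p\<in>S. \<forall>X\<in>tangent_space A p.
        linear_at A p (g p X) \<and>
        (\<forall>Y\<in>tangent_space A p. g p X Y = g p Y X) \<and>
        (X \<noteq> (\<lambda>_. 0) \<longrightarrow> g p X X > 0)) \<and>
     (\<forall>c\<in>A. \<forall>v w. smooth_on (snd c ` fst c)
        (\<lambda>x. g (chart_inv c x) (tvec_of A c (chart_inv c x) v) (tvec_of A c (chart_inv c x) w)))"

definition one_form :: "'a set \<Rightarrow> 'a chart set \<Rightarrow> ('a \<Rightarrow> 'a tvec \<Rightarrow> real) \<Rightarrow> bool" where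
  "one_form S A \<theta> \<longleftrightarrow>
     (\<forall>p\<in>S. linear_at A p (\<theta> p)) \<and>
     (\<forall>c\<in>A. \<forall>w. smooth_on (snd c ` fst c)
        (\<lambda>x. \<theta> (chart_inv c x) (tvec_of A c (chart_inv c x) w)))"

definition metric_norm :: "('a \<Rightarrow> 'a tvec \<Rightarrow> 'a tvec \<Rightarrow> real) \<Rightarrow> 'a \<Rightarrow> 'a tvec \<Rightarrow> real" where
  "metric_norm g p X = sqrt (g p X X)"

definition energy :: "('a \<Rightarrow> 'a tvec \<Rightarrow> 'a tvec \<Rightarrow> real) \<Rightarrow> 'a \<Rightarrow> 'a tvec \<Rightarrow> real" where
  "energy g p X = 1/2 * (metric_norm g p X)\<^sup>2"

definition magnetic_lagrangian ::
  "('a \<Rightarrow> 'a tvec \<Rightarrow> 'a tvec \<Rightarrow> real) \<Rightarrow> ('a \<Rightarrow> 'a tvec \<Rightarrow> real) \<Rightarrow> 'a \<Rightarrow> 'a tvec \<Rightarrow> real" where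
  "magnetic_lagrangian g \<theta> p X = 1/2 * (metric_norm g p X)\<^sup>2 + \<theta> p X"


section \<open>Curves\<close>

text \<open>The velocity at \<open>t\<close> of a curve defined on the interval \<open>I\<close>; one-sided at the endpoints.\<close>

definition velocity :: "'a chart set \<Rightarrow> real set \<Rightarrow> (real \<Rightarrow> 'a) \<Rightarrow> real \<Rightarrow> 'a tvec" where
  "velocity A I \<gamma> t = (\<lambda>d. if d \<in> A \<and> \<gamma> t \<in> fst d
     then vector_derivative (snd d \<circ> \<gamma>) (at t within I) else 0)"

definition C1_curve ::
  "'a::topological_space set \<Rightarrow> 'a chart set \<Rightarrow> real \<Rightarrow> real \<Rightarrow> (real \<Rightarrow> 'a) \<Rightarrow> bool" where
  "C1_curve S A a b \<gamma> \<longleftrightarrow>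
     continuous_on {a..b} \<gamma> \<and> \<gamma> ` {a..b} \<subseteq> S \<and>
     (\<forall>c\<in>A. \<forall>t\<in>{a..b}. \<gamma> t \<in> fst c \<longrightarrow>
        (snd c \<circ> \<gamma>) differentiable (at t within {a..b}) \<and>
        continuous (at t within {a..b})
          (\<lambda>s. vector_derivative (snd c \<circ> \<gamma>) (at s within {a..b})))"

definition piecewise_C1_curve ::
  "'a::topological_space set \<Rightarrow> 'a chart set \<Rightarrow> real \<Rightarrow> real \<Rightarrow> (real \<Rightarrow> 'a) \<Rightarrow> bool" where
  "piecewise_C1_curve S A a b \<gamma> \<longleftrightarrow>
     continuous_on {a..b} \<gamma> \<and> \<gamma> ` {a..b} \<subseteq> S \<and>
     (\<exists>F. finite F \<and>
        (\<forall>s\<in>{a..b}. \<forall>t\<in>{a..b}. s < t \<and> {s<..<t} \<inter> F = {} \<longrightarrow> C1_curve S A s t \<gamma>))"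


section \<open>The critical value of the universal cover\<close>

definition contractible_loop :: "'a::topological_space set \<Rightarrow> real \<Rightarrow> (real \<Rightarrow> 'a) \<Rightarrow> bool" where
  "contractible_loop S T \<gamma> \<longleftrightarrow>
     \<gamma> 0 = \<gamma> T \<and> (\<exists>q\<in>S. homotopic_loops S (\<lambda>s. \<gamma> (T * s)) (\<lambda>_. q))"

definition mane_cu ::
  "'a::topological_space set \<Rightarrow> 'a chart set \<Rightarrow> ('a \<Rightarrow> 'a tvec \<Rightarrow> real) \<Rightarrow> ereal" where
  "mane_cu S A L = Inf {ereal k | k.
     \<forall>T \<gamma>. T > 0 \<and> piecewise_C1_curve S A 0 T \<gamma> \<and> contractible_loop S T \<gamma> \<longrightarrow>
       integral {0..T} (\<lambda>t. L (\<gamma> t) (velocity A {0..T} \<gamma> t) + k) \<ge> 0}"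


section \<open>Submanifolds\<close>

text \<open>An embedded submanifold without boundary of dimension \<open>m \<in> {0, 1, 2}\<close>: around each of its
  points there is a slice chart compatible with the atlas. A closed submanifold is compact.\<close>

definition closed_connected_submanifold ::
  "'a::topological_space set \<Rightarrow> 'a chart set \<Rightarrow> 'a set \<Rightarrow> bool" where
  "closed_connected_submanifold S A Q \<longleftrightarrow>
     Q \<subseteq> S \<and> Q \<noteq> {} \<and> compact Q \<and> connected Q \<and>
     (\<exists>m. \<forall>p\<in>Q. \<exists>c V. smooth_atlas S (insert c A) \<and> p \<in> fst c \<and> subspace V \<and> dim V = m \<and>
        snd c ` (Q \<inter> fst c) = snd c ` fst c \<inter> V)"

text \<open>The vectors at \<open>p\<close> tangent to \<open>Q\<close>, as velocities of curves contained in \<open>Q\<close>.\<close>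

definition tangent_to :: "'a::topological_space set \<Rightarrow> 'a chart set \<Rightarrow> 'a set \<Rightarrow> 'a \<Rightarrow> 'a tvec set" where
  "tangent_to S A Q p = {velocity A {-\<delta>..\<delta>} \<alpha> 0 | \<alpha> \<delta>.
     \<delta> > 0 \<and> C1_curve S A (-\<delta>) \<delta> \<alpha> \<and> \<alpha> ` {-\<delta>..\<delta>} \<subseteq> Q \<and> \<alpha> 0 = p}"


section \<open>Euler-Lagrange orbits with conormal boundary conditions\<close>

definition local_lagrangian ::
  "'a chart set \<Rightarrow> ('a \<Rightarrow> 'a tvec \<Rightarrow> real) \<Rightarrow> 'a chart \<Rightarrow> real^2 \<Rightarrow> real^2 \<Rightarrow> real" where
  "local_lagrangian A L c x y = L (chart_inv c x) (tvec_of A c (chart_inv c x) y)"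

text \<open>In each chart, with \<open>x(t)\<close> the coordinate expression of the curve,
  \<open>d/dt (\<partial>L/\<partial>y)(x, x') = (\<partial>L/\<partial>x)(x, x')\<close>, tested on an arbitrary vector \<open>w\<close>.
  For the Lagrangians considered here, continuously differentiable solutions are automatically
  twice continuously differentiable, as \<open>\<partial>L/\<partial>y\<close> is invertible in \<open>y\<close>.\<close>

definition euler_lagrange ::
  "'a::topological_space set \<Rightarrow> 'a chart set \<Rightarrow> ('a \<Rightarrow> 'a tvec \<Rightarrow> real) \<Rightarrow>
   real \<Rightarrow> (real \<Rightarrow> 'a) \<Rightarrow> bool" where
  "euler_lagrange S A L T \<gamma> \<longleftrightarrow>
     C1_curve S A 0 T \<gamma> \<and>
     (\<forall>c\<in>A. \<forall>t\<in>{0..T}. \<gamma> t \<in> fst c \<longrightarrow> (\<forall>w.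
        let x = snd c \<circ> \<gamma>;
            y = (\<lambda>s. vector_derivative x (at s within {0..T}))
        in ((\<lambda>s. frechet_derivative (local_lagrangian A L c (x s)) (at (y s)) w)
              has_real_derivative
              frechet_derivative (\<lambda>z. local_lagrangian A L c z (y t)) (at (x t)) w)
             (at t within {0..T})))"

text \<open>The fiberwise differential \<open>d\<^sub>v L(q, X)\<close> applied to \<open>Y\<close>.\<close>

definition fiber_deriv :: "('a \<Rightarrow> 'a tvec \<Rightarrow> real) \<Rightarrow> 'a \<Rightarrow> 'a tvec \<Rightarrow> 'a tvec \<Rightarrow> real" where
  "fiber_deriv L q X Y = deriv (\<lambda>s. L q (tv_comb X s Y)) 0"

definition conormal_orbit ::
  "'a::topological_space set \<Rightarrow> 'a chart set \<Rightarrow> ('a \<Rightarrow> 'a tvec \<Rightarrow> real) \<Rightarrow> ('a \<Rightarrow> 'a tvec \<Rightarrow> real) \<Rightarrow>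
   'a set \<Rightarrow> 'a set \<Rightarrow> real \<Rightarrow> real \<Rightarrow> (real \<Rightarrow> 'a) \<Rightarrow> bool" where
  "conormal_orbit S A L E Q0 Q1 k T \<gamma> \<longleftrightarrow>
     T > 0 \<and> euler_lagrange S A L T \<gamma> \<and>
     (\<forall>t\<in>{0..T}. E (\<gamma> t) (velocity A {0..T} \<gamma> t) = k) \<and>
     \<gamma> 0 \<in> Q0 \<and> \<gamma> T \<in> Q1 \<and>
     (\<forall>Y\<in>tangent_to S A Q0 (\<gamma> 0). fiber_deriv L (\<gamma> 0) (velocity A {0..T} \<gamma> 0) Y = 0) \<and>
     (\<forall>Y\<in>tangent_to S A Q1 (\<gamma> T). fiber_deriv L (\<gamma> T) (velocity A {0..T} \<gamma> T) Y = 0)"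

end

theory Submission
  imports Defs
begin

text \<open>
  The orbits are obstructed already at their starting point. If \<open>Y\<close> is a unit vector tangent to \<open>Q0\<close>
  with \<open>\<bar>\<theta>(Y)\<bar> = 1\<close>, then a vector \<open>X\<close> that satisfies the conormal condition has \<open>\<langle>X, Y\<rangle> = - \<theta>(Y)\<close>,
  hence length at least \<open>1\<close> and energy at least \<open>1/2\<close>. So it suffices to find a metric, a one-form \<open>\<theta>\<close>
  and a contractible circle \<open>Q0 = Q1\<close> on whose unit tangent vectors \<open>\<theta>\<close> has absolute value \<open>1\<close>, and
  to keep the critical value at \<open>1/2\<close>. The latter amounts to the bound \<open>\<bar>\<theta>\<bar> \<le> 1\<close> on the whole surface.
  By completing the square it gives \<open>L + 1/2 \<ge> 0\<close>, while the circle itself, traversed at unit speed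
  against \<open>\<theta>\<close>, is a contractible loop with \<open>L = - 1/2\<close>. The critical value
  is thus exactly \<open>1/2\<close> (\<open>mane_cu_eq\<close>), the least energy that the conormal condition permits
  (\<open>conormal_imp_energy_ge\<close>).

  To have both the pointwise bound and equality on the circle, the metric is adapted to the one-form.
  In a chart, let \<open>b\<close> be a bump function with values in \<open>[0, 1]\<close>, supported near the circle of radius
  \<open>r\<close> around \<open>x0\<close> and equal to \<open>1\<close> exactly on it. With \<open>y = (x - x0) / r\<close>, take
  \<open>\<theta> = b (y\<^sub>1 dx\<^sub>2 - y\<^sub>2 dx\<^sub>1)\<close> and \<open>g = b\<^sup>2 \<bar>y\<bar>\<^sup>2 g\<^sub>e + (1 - b) g\<^sub>0\<close>, where \<open>g\<^sub>e\<close> is the Euclidean metric of the chart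
  and \<open>g\<^sub>0\<close> a background metric. The first summand alone dominates \<open>\<theta>\<^sup>2\<close> (\<open>ring_form_sq_le\<close>). The second
  one makes \<open>g\<close> positive definite off the circle, where the first may degenerate, and disappears on
  the circle, where \<open>g = g\<^sub>e\<close> (\<open>ring_metric_pos\<close>, \<open>on_ring_circle\<close>). The background metric is a sum
  of Euclidean metrics of charts cut off by bump functions (\<open>exists_cutoff_family\<close>).

  The circle is a submanifold in the sense of slice charts because an inversion straightens it
  (\<open>ring_circle_slice_chart\<close>).
\<close>

section \<open>Calculus of smooth maps\<close>

lemma frechet_derivative_cong_open:
  assumes "open U" "x \<in> U" "\<And>y. y \<in> U \<Longrightarrow> f y = g y"
  shows "frechet_derivative f (at x) = frechet_derivative g (at x)"
    and "f differentiable (at x) \<longleftrightarrow> g differentiable (at x)"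
proof -
  have "(f has_derivative D) (at x) \<longleftrightarrow> (g has_derivative D) (at x)" for D
    using has_derivative_transform_within_open[OF _ assms(1,2), of f D UNIV g]
      has_derivative_transform_within_open[OF _ assms(1,2), of g D UNIV f] assms(3) by auto
  then show "frechet_derivative f (at x) = frechet_derivative g (at x)"
    and "f differentiable (at x) \<longleftrightarrow> g differentiable (at x)"
    by (auto simp: frechet_derivative_def differentiable_def)
qed

text \<open>On an open set the derivative only sees the values there, so a function may be replaced by any
  other one that agrees with it on the domain; chart expressions are junk outside the chart image.\<close>
lemma Ck_on_cong:
  assumes "open U" "\<And>x. x \<in> U \<Longrightarrow> f x = g x" "Ck_on n U f"
  shows "Ck_on n U g"
  using assms(2,3)
proof (induction n arbitrary: f g)
  case 0
  then show ?case by (simp cong: continuous_on_cong)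
next
  case (Suc n)
  have "Ck_on n U (\<lambda>x. frechet_derivative g (at x) v)" for v
    by (rule Suc.IH[of "\<lambda>x. frechet_derivative f (at x) v"])
      (use Suc.prems frechet_derivative_cong_open(1)[OF assms(1), of _ f g] in auto)
  then show ?case
    using Suc.prems frechet_derivative_cong_open(2)[OF assms(1), of _ f g] by simp
qed

lemma Ck_on_subset: "Ck_on n U f \<Longrightarrow> V \<subseteq> U \<Longrightarrow> Ck_on n V f"
  by (induction n arbitrary: f) (auto intro: continuous_on_subset)

lemma Ck_on_imp_continuous_on: "Ck_on n U f \<Longrightarrow> continuous_on U f"
  by (cases n)
    (auto intro!: continuous_at_imp_continuous_on differentiable_imp_continuous_within)

lemma Ck_on_SucD: "Ck_on (Suc n) U f \<Longrightarrow> Ck_on n U f"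
proof (induction n arbitrary: f)
  case 0
  then show ?case using Ck_on_imp_continuous_on[OF "0.prems"] by simp
next
  case (Suc n)
  then show ?case by simp
qed

lemma Ck_on_SucI:
  assumes "open U" "\<And>x. x \<in> U \<Longrightarrow> (f has_derivative f' x) (at x)" "\<And>v. Ck_on n U (\<lambda>x. f' x v)"
  shows "Ck_on (Suc n) U f"
proof -
  have "f' x = frechet_derivative f (at x)" if "x \<in> U" for x
    using assms(2) that frechet_derivative_at by blast
  then have "Ck_on n U (\<lambda>x. frechet_derivative f (at x) v)" for v
    using Ck_on_cong[OF assms(1) _ assms(3)] by simp
  then show ?thesis using assms(2) by (auto simp: differentiable_def)
qed

lemma Ck_on_SucE:
  assumes "Ck_on (Suc n) U f"
  obtains f' where "\<And>x. x \<in> U \<Longrightarrow> (f has_derivative f' x) (at x)" "\<And>v. Ck_on n U (\<lambda>x. f' x v)"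
  using that[of "\<lambda>x. frechet_derivative f (at x)"] assms
  by (simp add: frechet_derivative_works)

text \<open>Differentiability of any order is a local property. It is the tool for functions cut off inside
  a chart, which are given by one formula near the support and by zero elsewhere.\<close>
lemma Ck_on_local:
  assumes "\<And>x. x \<in> U \<Longrightarrow> \<exists>V. open V \<and> x \<in> V \<and> Ck_on n V f"
  shows "Ck_on n U f"
  using assms
proof (induction n arbitrary: f)
  case 0
  then have "\<And>x. x \<in> U \<Longrightarrow> isCont f x"
    using continuous_on_eq_continuous_at by fastforce
  then show ?case by (simp add: continuous_at_imp_continuous_on)
next
  case (Suc n)
  have "f differentiable (at x)" if "x \<in> U" for x
    using Suc.prems[OF that] by auto
  moreover have "Ck_on n U (\<lambda>x. frechet_derivative f (at x) v)" for v
  proof (rule Suc.IH)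
    fix x assume "x \<in> U"
    from Suc.prems[OF this] obtain V where "open V" "x \<in> V" "Ck_on (Suc n) V f" by blast
    then show "\<exists>V. open V \<and> x \<in> V \<and> Ck_on n V (\<lambda>x. frechet_derivative f (at x) v)"
      by auto
  qed
  ultimately show ?case by simp
qed

lemma Ck_on_const: "Ck_on n U (\<lambda>x. c)"
  by (induction n arbitrary: c) auto

lemma Ck_on_bounded_linear_comp:
  assumes "bounded_linear h" "open U" "Ck_on n U f"
  shows "Ck_on n U (\<lambda>x. h (f x))"
  using assms(3)
proof (induction n arbitrary: f)
  case 0
  then show ?case using bounded_linear.continuous_on[OF assms(1)] by simp
next
  case (Suc n)
  obtain f' where
    "\<And>x. x \<in> U \<Longrightarrow> (f has_derivative f' x) (at x)" "\<And>v. Ck_on n U (\<lambda>x. f' x v)"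
    using Suc.prems by (rule Ck_on_SucE) blast
  then show ?case
    by (intro Ck_on_SucI[OF assms(2), where f' = "\<lambda>x v. h (f' x v)"] Suc.IH)
      (auto intro: bounded_linear.has_derivative[OF assms(1)])
qed

lemma Ck_on_add:
  assumes "open U" "Ck_on n U f" "Ck_on n U g"
  shows "Ck_on n U (\<lambda>x. f x + g x)"
  using assms(2,3)
proof (induction n arbitrary: f g)
  case 0
  then show ?case by (auto intro: continuous_on_add)
next
  case (Suc n)
  obtain f' where f': "\<And>x. x \<in> U \<Longrightarrow> (f has_derivative f' x) (at x)" "\<And>v. Ck_on n U (\<lambda>x. f' x v)"
    using Suc.prems(1) by (rule Ck_on_SucE) blast
  obtain g' where g': "\<And>x. x \<in> U \<Longrightarrow> (g has_derivative g' x) (at x)" "\<And>v. Ck_on n U (\<lambda>x. g' x v)"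
    using Suc.prems(2) by (rule Ck_on_SucE) blast
  show ?case
    by (rule Ck_on_SucI[OF assms(1), where f' = "\<lambda>x v. f' x v + g' x v"])
      (use f' g' in \<open>auto intro: has_derivative_add Suc.IH\<close>)
qed

lemma Ck_on_sum:
  assumes "open U" "\<And>i. i \<in> I \<Longrightarrow> Ck_on n U (f i)"
  shows "Ck_on n U (\<lambda>x. \<Sum>i\<in>I. f i x)"
  using assms(2) by (induction I rule: infinite_finite_induct)
    (auto simp: Ck_on_const intro: Ck_on_add[OF assms(1)])

lemma Ck_on_bilinear:
  assumes "bounded_bilinear h" "open U" "Ck_on n U f" "Ck_on n U g"
  shows "Ck_on n U (\<lambda>x. h (f x) (g x))"
  using assms(3,4)
proof (induction n arbitrary: f g)
  case 0
  then show ?case using bounded_bilinear.continuous_on[OF assms(1)] by auto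
next
  case (Suc n)
  obtain f' where f': "\<And>x. x \<in> U \<Longrightarrow> (f has_derivative f' x) (at x)" "\<And>v. Ck_on n U (\<lambda>x. f' x v)"
    using Suc.prems(1) by (rule Ck_on_SucE) blast
  obtain g' where g': "\<And>x. x \<in> U \<Longrightarrow> (g has_derivative g' x) (at x)" "\<And>v. Ck_on n U (\<lambda>x. g' x v)"
    using Suc.prems(2) by (rule Ck_on_SucE) blast
  have "Ck_on n U f" "Ck_on n U g"
    using Suc.prems Ck_on_SucD by blast+
  then show ?case
    by (intro Ck_on_SucI[OF assms(2), where f' = "\<lambda>x v. h (f x) (g' x v) + h (f' x v) (g x)"])
      (use f' g' in \<open>auto intro!: bounded_bilinear.FDERIV[OF assms(1)] Ck_on_add[OF assms(2)] Suc.IH\<close>)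
qed

text \<open>The chain rule gives \<open>D(f \<circ> g)(x) v = Df(g x) (Dg(x) v)\<close>, whose direction depends on \<open>x\<close>, whereas
  the induction hypothesis speaks of derivatives in fixed directions. Expanding \<open>Dg(x) v\<close> in the
  standard basis turns the right-hand side into a sum of products of functions of order \<open>n\<close>.\<close>
lemma Ck_on_compose:
  assumes "open U" "open V" "\<And>x. x \<in> U \<Longrightarrow> g x \<in> V" "Ck_on n V f" "Ck_on n U g"
  shows "Ck_on n U (\<lambda>x. f (g x))"
  using assms(4,5)
proof (induction n arbitrary: f)
  case 0
  then show ?case using continuous_on_compose2[of V f U g] assms(3) by auto
next
  case (Suc n)
  obtain f' where f': "\<And>x. x \<in> V \<Longrightarrow> (f has_derivative f' x) (at x)" "\<And>v. Ck_on n V (\<lambda>x. f' x v)"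
    using Suc.prems(1) by (rule Ck_on_SucE) blast
  obtain g' where g': "\<And>x. x \<in> U \<Longrightarrow> (g has_derivative g' x) (at x)" "\<And>v. Ck_on n U (\<lambda>x. g' x v)"
    using Suc.prems(2) by (rule Ck_on_SucE) blast
  have "((\<lambda>x. f (g x)) has_derivative (\<lambda>v. \<Sum>b\<in>Basis. (g' x v \<bullet> b) *\<^sub>R f' (g x) b)) (at x)" if "x \<in> U" for x
  proof -
    have f'x: "(f has_derivative f' (g x)) (at (g x))" using f'(1) assms(3) that by blast
    have "f' (g x) (g' x v) = (\<Sum>b\<in>Basis. (g' x v \<bullet> b) *\<^sub>R f' (g x) b)" for v
    proof -
      interpret linear "f' (g x)" using f'x by (rule has_derivative_linear)
      have "f' (g x) (g' x v) = f' (g x) (\<Sum>b\<in>Basis. (g' x v \<bullet> b) *\<^sub>R b)"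
        by (simp add: euclidean_representation)
      then show ?thesis by (simp add: sum scaleR)
    qed
    then show ?thesis using has_derivative_compose[OF g'(1)[OF that] f'x] by simp
  qed
  moreover have "Ck_on n U g" using Suc.prems(2) by (rule Ck_on_SucD)
  ultimately show ?case
    by (intro Ck_on_SucI[OF assms(1)])
      (auto intro!: Ck_on_sum assms(1) f'(2) Suc.IH g'(2) Ck_on_bilinear[OF bounded_bilinear_scaleR]
        Ck_on_bounded_linear_comp[OF bounded_linear_inner_left])
qed

lemma smooth_on_cong: "open U \<Longrightarrow> (\<And>x. x \<in> U \<Longrightarrow> f x = g x) \<Longrightarrow> smooth_on U f \<Longrightarrow> smooth_on U g"
  unfolding smooth_on_def using Ck_on_cong by metis

lemma smooth_on_subset: "smooth_on U f \<Longrightarrow> V \<subseteq> U \<Longrightarrow> smooth_on V f"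
  unfolding smooth_on_def using Ck_on_subset by metis

lemma smooth_on_local:
  assumes "\<And>x. x \<in> U \<Longrightarrow> \<exists>V. open V \<and> x \<in> V \<and> smooth_on V f"
  shows "smooth_on U f"
  unfolding smooth_on_def
  by (intro allI Ck_on_local) (use assms in \<open>auto simp: smooth_on_def\<close>)

lemma smooth_on_const: "smooth_on U (\<lambda>x. c)"
  by (simp add: smooth_on_def Ck_on_const)

lemma smooth_on_linear_comp:
  "bounded_linear h \<Longrightarrow> open U \<Longrightarrow> smooth_on U f \<Longrightarrow> smooth_on U (\<lambda>x. h (f x))"
  by (simp add: smooth_on_def Ck_on_bounded_linear_comp)

lemma smooth_on_add:
  "open U \<Longrightarrow> smooth_on U f \<Longrightarrow> smooth_on U g \<Longrightarrow> smooth_on U (\<lambda>x. f x + g x)"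
  by (simp add: smooth_on_def Ck_on_add)

lemma smooth_on_sum:
  "open U \<Longrightarrow> (\<And>i. i \<in> I \<Longrightarrow> smooth_on U (f i)) \<Longrightarrow> smooth_on U (\<lambda>x. \<Sum>i\<in>I. f i x)"
  by (simp add: smooth_on_def Ck_on_sum)

lemma smooth_on_diff:
  "open U \<Longrightarrow> smooth_on U f \<Longrightarrow> smooth_on U g \<Longrightarrow> smooth_on U (\<lambda>x. f x - g x)"
  using smooth_on_add[of U f "\<lambda>x. - g x"]
    smooth_on_linear_comp[OF bounded_linear_minus[OF bounded_linear_ident], of U g] by simp

lemma smooth_on_bilinear:
  "bounded_bilinear h \<Longrightarrow> open U \<Longrightarrow> smooth_on U f \<Longrightarrow> smooth_on U g \<Longrightarrow> smooth_on U (\<lambda>x. h (f x) (g x))"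
  by (simp add: smooth_on_def Ck_on_bilinear)

lemmas smooth_on_mult = smooth_on_bilinear[OF bounded_bilinear_mult]
  and smooth_on_scaleR = smooth_on_bilinear[OF bounded_bilinear_scaleR]
  and smooth_on_inner = smooth_on_bilinear[OF bounded_bilinear_inner]

lemma smooth_on_compose:
  assumes "smooth_on V f" "smooth_on U g" "open U" "open V" "g ` U \<subseteq> V"
  shows "smooth_on U (\<lambda>x. f (g x))"
  unfolding smooth_on_def
  by (rule allI, rule Ck_on_compose[OF assms(3,4)]) (use assms in \<open>auto simp: smooth_on_def\<close>)

lemma smooth_on_imp_continuous_on: "smooth_on U f \<Longrightarrow> continuous_on U f"
  unfolding smooth_on_def using Ck_on_imp_continuous_on by blast

lemma smooth_on_frechet_derivative:
  "smooth_on U f \<Longrightarrow> smooth_on U (\<lambda>x. frechet_derivative f (at x) v)"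
  unfolding smooth_on_def using Ck_on.simps(2) by blast

lemma smooth_on_differentiable: "smooth_on U f \<Longrightarrow> x \<in> U \<Longrightarrow> f differentiable (at x)"
  unfolding smooth_on_def using Ck_on.simps(2) by blast

lemma smooth_on_id: "smooth_on U (\<lambda>x. x)"
proof -
  have "Ck_on n UNIV (\<lambda>x. x)" for n
    by (cases n) (auto simp: Ck_on_const intro: Ck_on_SucI[where f' = "\<lambda>x v. v"] continuous_on_id)
  then show ?thesis
    unfolding smooth_on_def using Ck_on_subset by blast
qed

text \<open>The derivative \<open>- v / x\<^sup>2\<close> is a product of inverses, so the order climbs by induction.\<close>
lemma smooth_on_inverse: "smooth_on {x::real. x \<noteq> 0} inverse"
  unfolding smooth_on_def
proof
  have op: "open {x::real. x \<noteq> 0}" by (auto simp: Collect_neg_eq intro: open_Compl)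
  fix n
  show "Ck_on n {x::real. x \<noteq> 0} inverse"
  proof (induction n)
    case 0
    then show ?case by (auto intro: continuous_intros)
  next
    case (Suc n)
    show ?case
      by (rule Ck_on_SucI[OF op, where f' = "\<lambda>x v. - (inverse x * v * inverse x)"])
        (auto intro!: has_derivative_inverse' Ck_on_bounded_linear_comp[OF bounded_linear_minus[OF bounded_linear_ident] op]
          Ck_on_bilinear[OF bounded_bilinear_mult op] Ck_on_const Suc)
  qed
qed

section \<open>Bump functions\<close>

text \<open>For \<open>t > 0\<close>, all derivatives of \<open>exp (-1/t)\<close> are linear combinations of the functions
  \<open>t\<^sup>-\<^sup>n exp (-1/t)\<close>; treating them together closes the induction on the order.\<close>

definition flat_exp :: "nat \<Rightarrow> real \<Rightarrow> real" where
  "flat_exp n t = (if t > 0 then (1 / t) ^ n * exp (- (1 / t)) else 0)"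

lemma flat_exp_has_derivative:
  "(flat_exp n has_real_derivative flat_exp (n + 2) t - real n * flat_exp (n + 1) t) (at t)"
proof -
  consider "t > 0" | "t < 0" | "t = 0" by linarith
  then show ?thesis
  proof cases
    case 1
    have "((\<lambda>t. (1 / t) ^ n * exp (- (1 / t))) has_real_derivative
        flat_exp (n + 2) t - real n * flat_exp (n + 1) t) (at t)"
    proof -
      have "real n * (1 / t) ^ (n - 1) * (1 / t)\<^sup>2 = real n * (1 / t) ^ (n + 1)"
        by (cases n) (simp_all add: power2_eq_square)
      then have "(1 / t)\<^sup>2 * (1 / t) ^ n * exp (- (1 / t)) - real n * (1 / t) ^ (n - 1) * (1 / t)\<^sup>2 * exp (- (1 / t))
          = flat_exp (n + 2) t - real n * flat_exp (n + 1) t"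
        using 1 by (simp add: flat_exp_def power_add power2_eq_square)
      moreover have "((\<lambda>t. (1 / t) ^ n * exp (- (1 / t))) has_real_derivative
        (1 / t)\<^sup>2 * (1 / t) ^ n * exp (- (1 / t)) - real n * (1 / t) ^ (n - 1) * (1 / t)\<^sup>2 * exp (- (1 / t))) (at t)"
        using 1 by (auto intro!: derivative_eq_intros simp: power2_eq_square)
      ultimately show ?thesis by simp
    qed
    then show ?thesis
      by (rule has_field_derivative_transform_within_open[where S = "{0<..}"])
        (use 1 in \<open>auto simp: flat_exp_def\<close>)
  next
    case 2
    have "((\<lambda>t. 0) has_real_derivative flat_exp (n + 2) t - real n * flat_exp (n + 1) t) (at t)"
      using 2 by (simp add: flat_exp_def)
    then show ?thesis
      by (rule has_field_derivative_transform_within_open[where S = "{..<0}"])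
        (use 2 in \<open>auto simp: flat_exp_def\<close>)
  next
    case 3
    \<comment> \<open>With \<open>u = 1/t\<close>, the difference quotient at \<open>0\<close> becomes \<open>u\<^sup>n\<^sup>+\<^sup>1 / exp u\<close>.\<close>
    have "((\<lambda>t. (1 / t) ^ (n + 1) * exp (- (1 / t))) \<longlongrightarrow> 0) (at_right (0::real))"
    proof -
      have "((\<lambda>u::real. u ^ (n + 1) / exp u) \<longlongrightarrow> 0) at_top" by (rule tendsto_power_div_exp_0)
      from filterlim_compose[OF this filterlim_inverse_at_top_right]
      show ?thesis by (simp add: exp_minus divide_inverse)
    qed
    then have "((\<lambda>t. flat_exp n t / t) \<longlongrightarrow> 0) (at_right 0)"
      by (rule tendsto_cong[THEN iffD1, rotated])
        (auto simp: flat_exp_def eventually_at_filter field_simps)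
    moreover have "((\<lambda>t. flat_exp n t / t) \<longlongrightarrow> 0) (at_left 0)"
      by (rule tendsto_eventually) (auto simp: flat_exp_def eventually_at_filter)
    ultimately have "((\<lambda>t. flat_exp n t / t) \<longlongrightarrow> 0) (at 0)"
      by (simp add: filterlim_split_at)
    with 3 show ?thesis
      by (simp add: has_field_derivative_iff flat_exp_def)
  qed
qed

lemma smooth_on_flat_exp: "smooth_on UNIV (flat_exp n)"
  unfolding smooth_on_def
proof
  fix m show "Ck_on m UNIV (flat_exp n)"
  proof (induction m arbitrary: n)
    case 0
    then show ?case
      using flat_exp_has_derivative
      by (auto intro!: continuous_at_imp_continuous_on DERIV_isCont)
  next
    case (Suc m)
    show ?case
    proof (rule Ck_on_SucI)
      show "(flat_exp n has_derivative (*) (flat_exp (n + 2) t + (- real n) * flat_exp (n + 1) t)) (at t)" for t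
        using flat_exp_has_derivative[of n t] by (simp add: has_field_derivative_def)
      show "Ck_on m UNIV (\<lambda>t. (flat_exp (n + 2) t + (- real n) * flat_exp (n + 1) t) * v)" for v
        by (intro Ck_on_bilinear[OF bounded_bilinear_mult] Ck_on_add Ck_on_const Suc) auto
    qed simp
  qed
qed

text \<open>In terms of \<open>s = \<bar>x - x0\<bar>\<^sup>2 / r\<^sup>2\<close> this is \<open>exp (1 - 1 / (1 - (s - 1)\<^sup>2))\<close> for \<open>0 < s < 2\<close> and zero otherwise:
  a bump around the circle of radius \<open>r\<close> that reaches its maximum \<open>1\<close> exactly on this circle and is
  already zero at the centre.\<close>
definition ring_bump :: "real^2 \<Rightarrow> real \<Rightarrow> real^2 \<Rightarrow> real" where
  "ring_bump x0 r x = exp 1 * flat_exp 0 (1 - (((x - x0) \<bullet> (x - x0)) / r\<^sup>2 - 1)\<^sup>2)"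

definition ball_bump :: "real^2 \<Rightarrow> real \<Rightarrow> real^2 \<Rightarrow> real" where
  "ball_bump x0 r x = flat_exp 0 (1 - (x - x0) \<bullet> (x - x0) / r\<^sup>2)"

lemma smooth_on_flat_exp_comp: "smooth_on UNIV f \<Longrightarrow> smooth_on UNIV (\<lambda>x. flat_exp n (f x))"
  by (rule smooth_on_compose[OF smooth_on_flat_exp]) auto

lemma smooth_ring_bump: "smooth_on UNIV (ring_bump x0 r)"
  unfolding ring_bump_def[abs_def] power2_eq_square divide_inverse
  by (intro smooth_on_mult smooth_on_const smooth_on_flat_exp_comp smooth_on_diff smooth_on_inner
      smooth_on_id open_UNIV)

lemma smooth_ball_bump: "smooth_on UNIV (ball_bump x0 r)"
  unfolding ball_bump_def[abs_def] divide_inverse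
  by (intro smooth_on_mult smooth_on_const smooth_on_flat_exp_comp smooth_on_diff smooth_on_inner
      smooth_on_id open_UNIV)

lemma ring_bump_bounds:
  "0 \<le> ring_bump x0 r x" "ring_bump x0 r x \<le> 1"
  by (auto simp: ring_bump_def flat_exp_def field_simps simp flip: exp_add)

lemma ring_bump_eq_1: 
  assumes "r > 0"
  shows "ring_bump x0 r x = 1 \<longleftrightarrow> dist x0 x = r"
proof -
  let ?s = "((x - x0) \<bullet> (x - x0)) / r\<^sup>2"
  have "u < 1 \<and> 1 - 1 / (1 - u) = 0 \<longleftrightarrow> u = 0" for u :: real
    by (auto simp: field_simps)
  from this[of "(?s - 1)\<^sup>2"] have "ring_bump x0 r x = 1 \<longleftrightarrow> (?s - 1)\<^sup>2 = 0"
    unfolding ring_bump_def flat_exp_def by (auto simp flip: exp_add)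
  also have "\<dots> \<longleftrightarrow> ?s = 1" by simp
  also have "\<dots> \<longleftrightarrow> (norm (x - x0))\<^sup>2 = r\<^sup>2" using assms by (auto simp: power2_norm_eq_inner)
  also have "\<dots> \<longleftrightarrow> dist x0 x = r"
    using assms by (simp add: dist_norm norm_minus_commute)
  finally show ?thesis .
qed

lemma ring_bump_support:
  assumes "r > 0" "x \<notin> cball x0 (2 * r)"
  shows "ring_bump x0 r x = 0"
proof -
  have "norm (x - x0) > 2 * r" using assms(2) by (simp add: dist_norm norm_minus_commute)
  then have "(norm (x - x0))\<^sup>2 > (2 * r)\<^sup>2" using assms(1) by (intro power_strict_mono) auto
  then have "((x - x0) \<bullet> (x - x0)) / r\<^sup>2 > 4" using assms(1)
    by (simp add: power2_norm_eq_inner field_simps)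
  then have "(((x - x0) \<bullet> (x - x0)) / r\<^sup>2 - 1)\<^sup>2 > 1"
    by (simp add: power2_eq_square less_1_mult)
  then show ?thesis by (simp add: ring_bump_def flat_exp_def)
qed

lemma ball_bump_nonneg: "ball_bump x0 r x \<ge> 0"
  by (simp add: ball_bump_def flat_exp_def)

lemma ball_bump_pos_iff:
  assumes "r > 0"
  shows "ball_bump x0 r x > 0 \<longleftrightarrow> x \<in> ball x0 r"
proof -
  have "ball_bump x0 r x > 0 \<longleftrightarrow> (norm (x - x0))\<^sup>2 < r\<^sup>2"
    using assms by (simp add: ball_bump_def flat_exp_def power2_norm_eq_inner field_simps)
  also have "\<dots> \<longleftrightarrow> x \<in> ball x0 r"
    using assms power_mono_iff[of r "norm (x - x0)" 2]
    by (simp add: dist_norm norm_minus_commute flip: not_le)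
  finally show ?thesis .
qed

section \<open>Charts and functions supported in a chart\<close>

lemma chart_inv_in: "x \<in> snd c ` fst c \<Longrightarrow> chart_inv c x \<in> fst c"
  by (simp add: chart_inv_def inv_into_into)

lemma chart_chart_inv: "x \<in> snd c ` fst c \<Longrightarrow> snd c (chart_inv c x) = x"
  by (simp add: chart_inv_def f_inv_into_f)

lemma chart_inv_chart: "is_chart S c \<Longrightarrow> p \<in> fst c \<Longrightarrow> chart_inv c (snd c p) = p"
  by (simp add: is_chart_def homeomorphism_def)

lemma chart_domain_subset: "is_chart S c \<Longrightarrow> fst c \<subseteq> S"
  unfolding is_chart_def using openin_imp_subset by blast

lemma continuous_on_chart_inv: "is_chart S c \<Longrightarrow> continuous_on (snd c ` fst c) (chart_inv c)"
  by (simp add: is_chart_def homeomorphism_def)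

lemma chart_image_Int:
  assumes "is_chart S c"
  shows "snd c ` (fst c \<inter> W) = snd c ` fst c \<inter> chart_inv c -` W"
  using chart_inv_chart[OF assms] by (auto simp: chart_chart_inv chart_inv_in image_iff)

lemma open_chart_image:
  assumes "is_chart S c" "openin (top_of_set S) W"
  shows "open (snd c ` (fst c \<inter> W))"
proof -
  obtain O' where O': "open O'" "W = S \<inter> O'" using assms(2) by (auto simp: openin_open)
  then have "fst c \<inter> W = fst c \<inter> O'" using chart_domain_subset[OF assms(1)] by blast
  then have "snd c ` (fst c \<inter> W) = snd c ` fst c \<inter> chart_inv c -` O'"
    using chart_image_Int[OF assms(1)] by simp
  moreover have "open (snd c ` fst c)" using assms(1) by (simp add: is_chart_def)
  ultimately show ?thesis
    using continuous_open_preimage[OF continuous_on_chart_inv[OF assms(1)]] O'(1) by simp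
qed

lemma openin_chart_inv_image:
  assumes "is_chart S c" "open U" "U \<subseteq> snd c ` fst c"
  shows "openin (top_of_set S) (chart_inv c ` U)"
proof -
  have "openin (top_of_set (fst c)) (chart_inv c ` U)"
  proof (rule homeomorphism_imp_open_map)
    show "homeomorphism (snd c ` fst c) (fst c) (chart_inv c) (snd c)"
      using assms(1) unfolding is_chart_def by (blast intro: homeomorphism_symD)
    show "openin (top_of_set (snd c ` fst c)) U"
      using assms(2,3) by (auto simp: openin_open)
  qed
  then show ?thesis using assms(1) openin_trans unfolding is_chart_def by blast
qed

lemma atlas_chart: "smooth_atlas S A \<Longrightarrow> c \<in> A \<Longrightarrow> is_chart S c"
  unfolding smooth_atlas_def by blast

lemma open_chart_overlap:
  assumes "is_chart S c" "is_chart S d"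
  shows "open (snd c ` (fst c \<inter> fst d))"
  using open_chart_image[OF assms(1)] assms(2) by (simp add: is_chart_def)

lemma smooth_transition:
  "smooth_atlas S A \<Longrightarrow> c \<in> A \<Longrightarrow> d \<in> A \<Longrightarrow> smooth_on (snd c ` (fst c \<inter> fst d)) (transition c d)"
  by (simp add: smooth_atlas_def)

lemma transition_chart:
  "is_chart S c \<Longrightarrow> p \<in> fst c \<Longrightarrow> transition c d (snd c p) = snd d p"
  by (simp add: transition_def chart_inv_chart)

lemma transition_has_derivative:
  assumes "smooth_atlas S A" "c \<in> A" "d \<in> A" "p \<in> fst c" "p \<in> fst d"
  shows "(transition c d has_derivative frechet_derivative (transition c d) (at (snd c p))) (at (snd c p))"
  using smooth_on_differentiable[OF smooth_transition[OF assms(1-3)]] assms(4,5)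
    frechet_derivative_works by blast

definition chart_cutoff :: "'a chart \<Rightarrow> (real^2 \<Rightarrow> real) \<Rightarrow> bool" where
  "chart_cutoff d \<kappa> \<longleftrightarrow> smooth_on UNIV \<kappa> \<and>
     (\<exists>K. compact K \<and> K \<subseteq> snd d ` fst d \<and> (\<forall>x. x \<notin> K \<longrightarrow> \<kappa> x = 0))"

definition extend_by_zero :: "'a chart \<Rightarrow> (real^2 \<Rightarrow> real) \<Rightarrow> 'a \<Rightarrow> real" where
  "extend_by_zero d \<kappa> p = (if p \<in> fst d then \<kappa> (snd d p) else 0)"

text \<open>How a function supported in one chart \<open>d\<close> looks in another chart \<open>c\<close>. On the overlap the product is
  an honest formula in the transition map. Elsewhere it vanishes, and the point is that it vanishes on
  an open set: the compact support is closed in the whole surface because the surface is Hausdorff.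
  The two open sets cover the image of \<open>c\<close>. The factor \<open>F\<close> only has to be smooth on the overlap, which
  allows it to contain the components of a tangent vector in the chart \<open>d\<close>.\<close>
lemma smooth_cutoff_mult:
  fixes S :: "'a::t2_space set"
  assumes A: "smooth_atlas S A" "c \<in> A" "d \<in> A" and \<kappa>: "chart_cutoff d \<kappa>"
    and F: "smooth_on (snd c ` (fst c \<inter> fst d)) F"
  shows "smooth_on (snd c ` fst c) (\<lambda>x. extend_by_zero d \<kappa> (chart_inv c x) * F x)"
proof -
  note c = atlas_chart[OF A(1,2)] and d = atlas_chart[OF A(1,3)]
  obtain K where K: "compact K" "K \<subseteq> snd d ` fst d" "\<And>x. x \<notin> K \<Longrightarrow> \<kappa> x = 0"
    and sm: "smooth_on UNIV \<kappa>"
    using \<kappa> by (auto simp: chart_cutoff_def)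
  define U where "U = snd c ` (fst c \<inter> fst d)"
  define V where "V = snd c ` (fst c \<inter> (S - chart_inv d ` K))"
  have "open U" unfolding U_def using open_chart_overlap[OF c d] .
  have "closed (chart_inv d ` K)"
    by (intro compact_imp_closed compact_continuous_image K(1)
        continuous_on_subset[OF continuous_on_chart_inv[OF d] K(2)])
  then have "openin (top_of_set S) (S - chart_inv d ` K)"
    by (auto simp: openin_open intro!: exI[of _ "- chart_inv d ` K"])
  then have "open V" unfolding V_def using open_chart_image[OF c] by blast
  let ?G = "\<lambda>x. extend_by_zero d \<kappa> (chart_inv c x) * F x"
  have "smooth_on U ?G"
  proof (rule smooth_on_cong[OF \<open>open U\<close>])
    show "smooth_on U (\<lambda>x. \<kappa> (transition c d x) * F x)"
      using smooth_transition[OF A] F unfolding U_def[symmetric]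
      by (intro smooth_on_mult \<open>open U\<close> smooth_on_compose[OF sm]) auto
    show "\<kappa> (transition c d x) * F x = ?G x" if "x \<in> U" for x
      using that by (auto simp: U_def extend_by_zero_def transition_def chart_inv_chart[OF c])
  qed
  moreover have "smooth_on V ?G"
  proof (rule smooth_on_cong[OF \<open>open V\<close> _ smooth_on_const[of _ 0]])
    fix x assume "x \<in> V"
    then obtain p where p: "x = snd c p" "p \<in> fst c" "p \<notin> chart_inv d ` K" by (auto simp: V_def)
    then have "p \<in> fst d \<Longrightarrow> snd d p \<notin> K" using chart_inv_chart[OF d] by (metis image_eqI)
    then show "0 = ?G x"
      using p K(3) by (auto simp: extend_by_zero_def chart_inv_chart[OF c])
  qed
  moreover have "snd c ` fst c \<subseteq> U \<union> V"
  proof -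
    have "chart_inv d ` K \<subseteq> fst d" using K(2) chart_inv_in[of _ d] by blast
    then show ?thesis using chart_domain_subset[OF c] unfolding U_def V_def by blast
  qed
  ultimately show ?thesis
    using \<open>open U\<close> \<open>open V\<close> by (intro smooth_on_local) blast
qed

lemma smooth_tvec_component:
  assumes "smooth_atlas S A" "c \<in> A" "d \<in> A"
  shows "smooth_on (snd c ` (fst c \<inter> fst d)) (\<lambda>x. tvec_of A c (chart_inv c x) v d)"
proof (rule smooth_on_cong)
  show "open (snd c ` (fst c \<inter> fst d))"
    using open_chart_overlap atlas_chart assms by blast
  show "smooth_on (snd c ` (fst c \<inter> fst d)) (\<lambda>x. frechet_derivative (transition c d) (at x) v)"
    by (intro smooth_on_frechet_derivative smooth_transition[OF assms])
qed (use assms chart_inv_chart[OF atlas_chart[OF assms(1,2)]] in \<open>auto simp: tvec_of_def\<close>)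

text \<open>A substitute for a partition of unity: finitely many nonnegative bumps that do not all vanish at
  any point. The bumps need not add up to one, since a positive combination of inner products is an
  inner product whatever the coefficients are.\<close>
lemma exists_cutoff_family:
  fixes S :: "'a::t2_space set"
  assumes A: "smooth_atlas S A" and "compact S"
  shows "\<exists>J. finite J \<and> (\<forall>(d, \<kappa>)\<in>J. d \<in> A \<and> chart_cutoff d \<kappa> \<and> (\<forall>x. \<kappa> x \<ge> 0)) \<and>
    (\<forall>p\<in>S. \<exists>(d, \<kappa>)\<in>J. p \<in> fst d \<and> extend_by_zero d \<kappa> p > 0)"
proof -
  define good where "good = (\<lambda>(d::'a chart, \<kappa>). d \<in> A \<and> chart_cutoff d \<kappa> \<and> (\<forall>x. \<kappa> x \<ge> 0))"
  define D where "D = (\<lambda>(d::'a chart, \<kappa>). {p \<in> fst d. extend_by_zero d \<kappa> p > 0})"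
  define \<C> where "\<C> = {D j | j. good j \<and> openin (top_of_set S) (D j)}"
  have "\<exists>C\<in>\<C>. p \<in> C" if "p \<in> S" for p
  proof -
    have "S = (\<Union>c\<in>A. fst c)" using A by (simp only: smooth_atlas_def)
    with that obtain d where d: "d \<in> A" "p \<in> fst d" by blast
    note ch = atlas_chart[OF A d(1)]
    obtain r where r: "r > 0" "cball (snd d p) r \<subseteq> snd d ` fst d"
      using ch d(2) open_contains_cball[of "snd d ` fst d"] by (auto simp: is_chart_def)
    let ?\<kappa> = "ball_bump (snd d p) r"
    have zero: "?\<kappa> x = 0" if "x \<notin> cball (snd d p) r" for x
      using that ball_bump_pos_iff[OF r(1), of "snd d p" x] ball_bump_nonneg[of "snd d p" r x]
      by (simp add: less_le)
    have "chart_cutoff d ?\<kappa>"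
      unfolding chart_cutoff_def
      by (intro conjI exI[of _ "cball (snd d p) r"] allI impI smooth_ball_bump compact_cball r(2) zero)
    then have g: "good (d, ?\<kappa>)" using d ball_bump_nonneg by (simp add: good_def)
    have "D (d, ?\<kappa>) = {p' \<in> fst d. snd d p' \<in> ball (snd d p) r}"
      using ball_bump_pos_iff[OF r(1)] by (auto simp: D_def extend_by_zero_def)
    also have "\<dots> = chart_inv d ` ball (snd d p) r"
    proof -
      have "ball (snd d p) r \<subseteq> snd d ` fst d" using r(2) ball_subset_cball by blast
      then show ?thesis
        using chart_inv_chart[OF ch] chart_inv_in[of _ d] chart_chart_inv[of _ d]
        by (auto simp del: mem_ball) (metis image_eqI)
    qed
    finally have "D (d, ?\<kappa>) = chart_inv d ` ball (snd d p) r" .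
    moreover have "p \<in> chart_inv d ` ball (snd d p) r"
      using chart_inv_chart[OF ch d(2)] r(1) by (metis centre_in_ball image_eqI)
    moreover have "openin (top_of_set S) (chart_inv d ` ball (snd d p) r)"
      using r(2) by (intro openin_chart_inv_image[OF ch]) (auto simp: subset_iff)
    ultimately have "p \<in> D (d, ?\<kappa>)" "openin (top_of_set S) (D (d, ?\<kappa>))" by simp_all
    then show ?thesis using g unfolding \<C>_def by blast
  qed
  moreover have "\<forall>C\<in>\<C>. openin (top_of_set S) C" by (auto simp: \<C>_def)
  moreover from calculation have "S \<subseteq> \<Union>\<C>" by blast
  ultimately obtain F where F: "F \<subseteq> \<C>" "finite F" "S \<subseteq> \<Union>F"
    using compact_eq_openin_cover[THEN iffD1, rule_format, OF \<open>compact S\<close>, of \<C>] by auto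
  have "\<forall>C\<in>F. \<exists>j. good j \<and> C = D j" using F(1) unfolding \<C>_def by blast
  then obtain j where j: "\<forall>C\<in>F. good (j C) \<and> C = D (j C)" by metis
  show ?thesis
  proof (intro exI[of _ "j ` F"] conjI ballI)
    fix p assume "p \<in> S"
    then obtain C where C: "C \<in> F" "p \<in> C" using F(3) by blast
    obtain d \<kappa> where "j C = (d, \<kappa>)" by (cases "j C")
    with C j have "p \<in> D (d, \<kappa>)" "(d, \<kappa>) \<in> j ` F" by (metis, metis image_eqI)
    then show "\<exists>(d, \<kappa>)\<in>j ` F. p \<in> fst d \<and> extend_by_zero d \<kappa> p > 0"
      by (intro bexI[of _ "(d, \<kappa>)"]) (simp_all add: D_def)
  next
    fix z assume "z \<in> j ` F"
    then have "good z" using j by blast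
    then show "case z of (d, \<kappa>) \<Rightarrow> d \<in> A \<and> chart_cutoff d \<kappa> \<and> (\<forall>x. \<kappa> x \<ge> 0)"
      by (simp add: good_def)
  qed (use F(2) in simp)
qed

text \<open>Restricting a chart to a part \<open>U\<close> of its image and applying a diffeomorphism there gives a
  compatible chart. This is how slice charts of a submanifold arise.\<close>
lemma smooth_atlas_insert_reparam:
  assumes A: "smooth_atlas S A" "c \<in> A" and U: "open U" "U \<subseteq> snd c ` fst c"
    and \<Phi>: "smooth_on U \<Phi>" "open (\<Phi> ` U)" and \<Psi>: "smooth_on (\<Phi> ` U) \<Psi>" "\<And>x. x \<in> U \<Longrightarrow> \<Psi> (\<Phi> x) = x"
  shows "smooth_atlas S (insert (chart_inv c ` U, \<Phi> \<circ> snd c) A)"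
proof -
  note c = atlas_chart[OF A]
  define e where "e = (chart_inv c ` U, \<Phi> \<circ> snd c)"
  have sU: "snd c (chart_inv c x) = x" if "x \<in> U" for x
    by (rule chart_chart_inv) (use that U(2) in blast)
  have sV: "snd c ` fst e = U"
    using sU by (simp add: e_def image_image)
  then have img: "snd e ` fst e = \<Phi> ` U"
    by (simp only: e_def fst_conv snd_conv image_comp [symmetric])
  have fste: "fst e \<subseteq> fst c" using U(2) chart_inv_in[of _ c] by (auto simp: e_def)
  have inj: "inj_on (snd e) (fst e)"
  proof (rule inj_on_inverseI[where g = "\<lambda>z. chart_inv c (\<Psi> z)"])
    show "chart_inv c (\<Psi> (snd e p)) = p" if "p \<in> fst e" for p
      using that sU \<Psi>(2) by (auto simp: e_def)
  qed
  have einv: "chart_inv e (\<Phi> x) = chart_inv c x" if "x \<in> U" for x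
  proof -
    have "snd e (chart_inv c x) = \<Phi> x" "chart_inv c x \<in> fst e" using that sU by (auto simp: e_def)
    then show ?thesis using inj unfolding chart_inv_def[of e] by (metis inv_into_f_f)
  qed
  have e: "is_chart S e"
    unfolding is_chart_def img
  proof (intro conjI \<Phi>(2))
    show "openin (top_of_set S) (fst e)"
      using openin_chart_inv_image[OF c U] by (simp add: e_def)
    show "homeomorphism (fst e) (\<Phi> ` U) (snd e) (chart_inv e)"
    proof (rule homeomorphismI)
      have "continuous_on (fst e) (snd c)"
        using c fste by (auto simp: is_chart_def homeomorphism_def intro: continuous_on_subset)
      then show "continuous_on (fst e) (snd e)"
        using smooth_on_imp_continuous_on[OF \<Phi>(1)] sV continuous_on_compose[of "fst e" "snd c" \<Phi>]
        by (simp add: e_def)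
      have "continuous_on (\<Phi> ` U) (\<lambda>z. chart_inv c (\<Psi> z))"
        by (rule continuous_on_compose2[OF continuous_on_subset[OF continuous_on_chart_inv[OF c] U(2)]
              smooth_on_imp_continuous_on[OF \<Psi>(1)]]) (use \<Psi>(2) in auto)
      then show "continuous_on (\<Phi> ` U) (chart_inv e)"
        by (rule continuous_on_eq) (use \<Psi>(2) einv in auto)
      show "chart_inv e (snd e p) = p" if "p \<in> fst e" for p
        using that inj by (simp add: chart_inv_def)
    qed (use img einv sU in \<open>auto simp: e_def\<close>)
  qed
  have coord: "snd e ` (fst e \<inter> W) = \<Phi> ` (U \<inter> snd c ` (fst c \<inter> W))" for W
  proof -
    have "p \<in> fst e" if "p \<in> fst c" "snd c p \<in> U" for p
      using chart_inv_chart[OF c that(1)] that(2) unfolding e_def by (metis fst_conv image_eqI)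
    then have "snd c ` (fst e \<inter> W) = U \<inter> snd c ` (fst c \<inter> W)"
      using sV fste by blast
    then show ?thesis by (simp only: e_def fst_conv snd_conv image_comp [symmetric])
  qed
  have ed: "smooth_on (snd e ` (fst e \<inter> fst d)) (transition e d)" if d: "d \<in> A" for d
  proof -
    have op: "open (snd e ` (fst e \<inter> fst d))" using open_chart_overlap[OF e atlas_chart[OF A(1) d]] .
    have "smooth_on (snd e ` (fst e \<inter> fst d)) (\<lambda>z. transition c d (\<Psi> z))"
      by (rule smooth_on_compose[OF smooth_transition[OF A d] smooth_on_subset[OF \<Psi>(1)] op
            open_chart_overlap[OF c atlas_chart[OF A(1) d]]])
        (use \<Psi>(2) in \<open>auto simp: coord\<close>)
    then show ?thesis
      by (rule smooth_on_cong[OF op, rotated]) (use \<Psi>(2) einv in \<open>auto simp: coord transition_def\<close>)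
  qed
  have de: "smooth_on (snd d ` (fst d \<inter> fst e)) (transition d e)" if d: "d \<in> A" for d
  proof -
    note d' = atlas_chart[OF A(1) d]
    have op: "open (snd d ` (fst d \<inter> fst e))" using open_chart_overlap[OF d' e] .
    have U': "snd c p \<in> U" if "p \<in> fst e" for p using that sV by blast
    have "smooth_on (snd d ` (fst d \<inter> fst e)) (\<lambda>z. \<Phi> (transition d c z))"
      by (rule smooth_on_compose[OF \<Phi>(1) smooth_on_subset[OF smooth_transition[OF A(1) d A(2)]] op U(1)])
        (use fste U' in \<open>auto simp: transition_chart[OF d']\<close>)
    then show ?thesis
      by (rule smooth_on_cong[OF op, rotated]) (auto simp: transition_def e_def)
  qed
  have ee: "smooth_on (snd e ` (fst e \<inter> fst e)) (transition e e)"
    by (rule smooth_on_cong[OF _ _ smooth_on_id])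
      (use open_chart_overlap[OF e e] chart_chart_inv[of _ e] in \<open>auto simp: transition_def\<close>)
  have "smooth_atlas S (insert e A)"
    using A(1) e ed de ee chart_domain_subset[OF e] unfolding smooth_atlas_def by auto
  then show ?thesis by (simp add: e_def)
qed

section \<open>The metric and the one-form\<close>

definition rot :: "real^2 \<Rightarrow> real^2" where
  "rot y = vector [- (y $ 2), y $ 1]"

lemma bounded_linear_rot: "bounded_linear rot"
  by (rule linear_conv_bounded_linear[THEN iffD1], rule linearI) (simp_all add: rot_def vec_eq_iff forall_2)

lemma inner_rot_rot: "rot y \<bullet> rot y = y \<bullet> y"
  by (simp add: rot_def inner_vec_def sum_2)

text \<open>The Jacobians of the transition maps determine a tangent vector from its components in one chart.\<close>
lemma tangent_vector_eq_0:
  assumes A: "smooth_atlas S A" "d \<in> A" and p: "p \<in> fst d" and X: "X \<in> tangent_space A p" "X d = 0"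
  shows "X = (\<lambda>_. 0)"
proof
  fix e show "X e = 0"
  proof (cases "e \<in> A \<and> p \<in> fst e")
    case True
    then have "X e = frechet_derivative (transition d e) (at (snd d p)) (X d)"
      using X(1) A(2) p unfolding tangent_space_def by blast
    moreover have "linear (frechet_derivative (transition d e) (at (snd d p)))"
      by (rule has_derivative_linear, rule transition_has_derivative[OF A _ p]) (use True in auto)
    ultimately show ?thesis using X(2) by (simp add: linear_0)
  next
    case False
    then show ?thesis using X(1) unfolding tangent_space_def by blast
  qed
qed

text \<open>The data of the construction. The disc in the image of \<open>c\<close> has twice the radius of the circle to make
  room for the support of \<open>ring_bump\<close>; the family \<open>J\<close> yields the background metric.\<close>
locale ring_lagrangian =
  fixes S :: "'a::t2_space set" and A :: "'a chart set"
    and J :: "('a chart \<times> (real^2 \<Rightarrow> real)) set"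
    and c :: "'a chart" and x0 :: "real^2" and r :: real
  assumes atlas: "smooth_atlas S A"
    and finite_J: "finite J"
    and cutoff_J: "(d, \<kappa>) \<in> J \<Longrightarrow> d \<in> A \<and> chart_cutoff d \<kappa> \<and> (\<forall>x. \<kappa> x \<ge> 0)"
    and cover_J: "p \<in> S \<Longrightarrow> \<exists>(d, \<kappa>)\<in>J. p \<in> fst d \<and> extend_by_zero d \<kappa> p > 0"
    and c_in_A: "c \<in> A" and r_pos: "r > 0" and cball_subset: "cball x0 (2 * r) \<subseteq> snd c ` fst c"
begin

definition background :: "'a \<Rightarrow> 'a tvec \<Rightarrow> 'a tvec \<Rightarrow> real" where
  "background p X Y = (\<Sum>(d, \<kappa>)\<in>J. extend_by_zero d \<kappa> p * (X d \<bullet> Y d))"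

definition bump :: "'a \<Rightarrow> real" where
  "bump = extend_by_zero c (ring_bump x0 r)"

text \<open>This weight is the square of the Euclidean length of \<open>bump\<close> times the rotational covector
  \<open>rot (x - x0) / r\<close>. It is therefore the least multiple of the Euclidean metric that bounds the square
  of the one-form \<open>ring_form\<close> below.\<close>
definition inner_weight :: "'a \<Rightarrow> real" where
  "inner_weight = extend_by_zero c (\<lambda>x. (ring_bump x0 r x)\<^sup>2 * ((x - x0) \<bullet> (x - x0) / r\<^sup>2))"

text \<open>The first summand may degenerate off the circle, for instance at \<open>x0\<close> and outside the chart, but there
  the background metric has a positive coefficient. The background metric is switched off precisely on
  the circle, where the weight is \<open>1\<close>; there the sum is the Euclidean metric of the chart.\<close>
definition ring_metric :: "'a \<Rightarrow> 'a tvec \<Rightarrow> 'a tvec \<Rightarrow> real" where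
  "ring_metric p X Y = inner_weight p * (X c \<bullet> Y c) + (1 - bump p) * background p X Y"

definition ring_form :: "'a \<Rightarrow> 'a tvec \<Rightarrow> real" where
  "ring_form p X = bump p * (rot (snd c p - x0) \<bullet> X c / r)"

definition ring_circle :: "'a set" where
  "ring_circle = chart_inv c ` sphere x0 r"

lemma chart_c: "is_chart S c"
  using atlas_chart atlas c_in_A by blast

lemma bump_bounds: "0 \<le> bump p" "bump p \<le> 1"
  by (simp_all add: bump_def extend_by_zero_def ring_bump_bounds)

lemma inner_weight_nonneg: "0 \<le> inner_weight p"
  by (simp add: inner_weight_def extend_by_zero_def)

lemma cutoff_nonneg: "(d, \<kappa>) \<in> J \<Longrightarrow> 0 \<le> extend_by_zero d \<kappa> p"
  using cutoff_J by (simp add: extend_by_zero_def)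

lemma background_nonneg: "0 \<le> background p X X"
  unfolding background_def by (intro sum_nonneg) (auto intro!: mult_nonneg_nonneg cutoff_nonneg)

lemma ring_metric_nonneg: "0 \<le> ring_metric p X X"
  unfolding ring_metric_def
  by (intro add_nonneg_nonneg mult_nonneg_nonneg inner_weight_nonneg background_nonneg)
    (simp_all add: bump_bounds)

lemma ring_metric_sym: "ring_metric p X Y = ring_metric p Y X"
  by (simp add: ring_metric_def background_def inner_commute)

lemma background_comb:
  "background p X (tv_comb Y s Z) = background p X Y + s * background p X Z"
  by (simp add: background_def tv_comb_def sum_distrib_left split_def algebra_simps inner_simps
      flip: sum.distrib)

lemma ring_metric_comb:
  "ring_metric p X (tv_comb Y s Z) = ring_metric p X Y + s * ring_metric p X Z"
  by (simp add: ring_metric_def background_comb) (simp add: tv_comb_def algebra_simps inner_simps)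

lemma ring_form_comb: "ring_form p (tv_comb X s Y) = ring_form p X + s * ring_form p Y"
  by (simp add: ring_form_def tv_comb_def algebra_simps inner_simps add_divide_distrib)

lemma on_circle:
  assumes "p \<in> ring_circle"
  shows "p \<in> fst c" "dist x0 (snd c p) = r"
proof -
  obtain x where x: "dist x0 x = r" "p = chart_inv c x" using assms by (auto simp: ring_circle_def)
  then have "x \<in> snd c ` fst c" using r_pos cball_subset by (auto simp: subset_iff)
  then show "p \<in> fst c" "dist x0 (snd c p) = r" using x chart_inv_in[of x c] chart_chart_inv[of x c] by auto
qed

lemma bump_eq_1_iff: "bump p = 1 \<longleftrightarrow> p \<in> fst c \<and> dist x0 (snd c p) = r"
  by (simp add: bump_def extend_by_zero_def ring_bump_eq_1[OF r_pos])

lemma ring_metric_when_bump_1: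
  assumes "bump p = 1"
  shows "ring_metric p X Y = X c \<bullet> Y c"
proof -
  have "p \<in> fst c" and d: "dist x0 (snd c p) = r" using assms bump_eq_1_iff by auto
  then have "inner_weight p = (norm (snd c p - x0))\<^sup>2 / r\<^sup>2"
    by (simp add: inner_weight_def extend_by_zero_def ring_bump_eq_1[OF r_pos, THEN iffD2] power2_norm_eq_inner)
  also have "\<dots> = 1" using d r_pos by (simp add: dist_norm norm_minus_commute)
  finally show ?thesis using assms by (simp add: ring_metric_def)
qed

lemma ring_metric_pos:
  assumes p: "p \<in> S" and X: "X \<in> tangent_space A p" "X \<noteq> (\<lambda>_. 0)"
  shows "ring_metric p X X > 0"
proof (cases "bump p = 1")
  case True
  then have "X c \<noteq> 0"
    using tangent_vector_eq_0[OF atlas c_in_A _ X(1)] X(2) bump_eq_1_iff by blast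
  then show ?thesis by (simp add: ring_metric_when_bump_1[OF True])
next
  case False
  obtain d \<kappa> where d: "(d, \<kappa>) \<in> J" "p \<in> fst d" "extend_by_zero d \<kappa> p > 0"
    using cover_J[OF p] by blast
  then have "X d \<noteq> 0"
    using tangent_vector_eq_0[OF atlas _ _ X(1)] X(2) cutoff_J by blast
  then have "background p X X > 0"
    unfolding background_def using d
    by (intro sum_pos2[OF finite_J d(1)]) (auto intro!: mult_nonneg_nonneg cutoff_nonneg)
  moreover have "bump p < 1" using bump_bounds(2)[of p] False by simp
  ultimately have "(1 - bump p) * background p X X > 0" by simp
  moreover have "inner_weight p * (X c \<bullet> X c) \<ge> 0" by (simp add: inner_weight_nonneg)
  ultimately show ?thesis by (simp add: ring_metric_def)
qed

lemma cutoff_ring: "smooth_on UNIV F \<Longrightarrow> chart_cutoff c (\<lambda>x. ring_bump x0 r x * F x)"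
  unfolding chart_cutoff_def
  using cball_subset
  by (intro conjI exI[of _ "cball x0 (2 * r)"] smooth_on_mult smooth_ring_bump)
    (simp_all add: ring_bump_support[OF r_pos])

lemma riemannian_ring_metric: "riemannian_metric S A ring_metric"
  unfolding riemannian_metric_def
proof (intro conjI ballI allI impI)
  fix d v w assume d: "d \<in> A"
  let ?P = "chart_inv d" and ?v = "\<lambda>x. tvec_of A d (chart_inv d x) v" and ?w = "\<lambda>x. tvec_of A d (chart_inv d x) w"
  have op: "open (snd d ` fst d)" using atlas_chart[OF atlas d] by (simp add: is_chart_def)
  have inner: "smooth_on (snd d ` (fst d \<inter> fst e)) (\<lambda>x. ?v x e \<bullet> ?w x e)" if "e \<in> A" for e
    by (intro smooth_on_inner smooth_tvec_component[OF atlas d that]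
        open_chart_overlap[OF atlas_chart[OF atlas d] atlas_chart[OF atlas that]])
  have "chart_cutoff c (\<lambda>x. ring_bump x0 r x * (ring_bump x0 r x * ((x - x0) \<bullet> (x - x0) * inverse (r\<^sup>2))))"
    by (intro cutoff_ring smooth_on_mult smooth_ring_bump smooth_on_const smooth_on_diff
        smooth_on_inner smooth_on_id open_UNIV)
  from smooth_cutoff_mult[OF atlas d c_in_A this inner[OF c_in_A]]
  have 1: "smooth_on (snd d ` fst d) (\<lambda>x. inner_weight (?P x) * (?v x c \<bullet> ?w x c))"
    by (simp add: inner_weight_def power2_eq_square divide_inverse mult.assoc)
  have "chart_cutoff c (\<lambda>x. ring_bump x0 r x * 1)"
    by (intro cutoff_ring smooth_on_const)
  from smooth_cutoff_mult[OF atlas d c_in_A this smooth_on_const[of _ 1]]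
  have 2: "smooth_on (snd d ` fst d) (\<lambda>x. bump (?P x))"
    by (simp add: bump_def)
  have 3: "smooth_on (snd d ` fst d) (\<lambda>x. background (?P x) (?v x) (?w x))"
    unfolding background_def split_def
  proof (intro smooth_on_sum op)
    fix j assume "j \<in> J"
    then have "fst j \<in> A" "chart_cutoff (fst j) (snd j)" using cutoff_J[of "fst j" "snd j"] by auto
    then show "smooth_on (snd d ` fst d)
        (\<lambda>x. extend_by_zero (fst j) (snd j) (?P x) * (?v x (fst j) \<bullet> ?w x (fst j)))"
      by (intro smooth_cutoff_mult[OF atlas d] inner)
  qed
  show "smooth_on (snd d ` fst d) (\<lambda>x. ring_metric (?P x) (?v x) (?w x))"
    unfolding ring_metric_def
    by (intro smooth_on_add smooth_on_mult smooth_on_diff smooth_on_const 1 2 3 op)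
qed (auto simp: linear_at_def ring_metric_comb ring_metric_sym intro: ring_metric_pos)

lemma one_form_ring_form: "one_form S A ring_form"
  unfolding one_form_def
proof (intro conjI ballI allI)
  fix d w assume d: "d \<in> A"
  let ?U = "snd d ` (fst d \<inter> fst c)"
  have op: "open ?U" using open_chart_overlap[OF atlas_chart[OF atlas d] chart_c] .
  have F: "smooth_on ?U (\<lambda>x. (rot (transition d c x - x0) \<bullet> tvec_of A d (chart_inv d x) w c) * inverse r)"
    by (intro smooth_on_mult smooth_on_inner smooth_on_const smooth_on_diff op
        smooth_tvec_component[OF atlas d c_in_A] smooth_transition[OF atlas d c_in_A]
        smooth_on_linear_comp[OF bounded_linear_rot])
  have "chart_cutoff c (\<lambda>x. ring_bump x0 r x * 1)"
    by (intro cutoff_ring smooth_on_const)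
  from smooth_cutoff_mult[OF atlas d c_in_A this F]
  show "smooth_on (snd d ` fst d) (\<lambda>x. ring_form (chart_inv d x) (tvec_of A d (chart_inv d x) w))"
    by (simp add: ring_form_def bump_def transition_def divide_inverse mult.assoc)
qed (simp add: linear_at_def ring_form_comb)

text \<open>The one-form has norm at most \<open>1\<close>: by the Cauchy-Schwarz inequality its square is bounded by the
  first summand of the metric alone, and the second summand only helps. The bound is wanted for every
  family \<open>X\<close> of coordinate vectors, because the velocity of a piecewise smooth curve at a break point
  need not be a tangent vector.\<close>
lemma ring_form_sq_le: "(ring_form p X)\<^sup>2 \<le> ring_metric p X X"
proof -
  have "(ring_form p X)\<^sup>2 \<le> inner_weight p * (X c \<bullet> X c)"
  proof (cases "p \<in> fst c")
    case True
    let ?y = "snd c p - x0"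
    have "(rot ?y \<bullet> X c)\<^sup>2 \<le> (?y \<bullet> ?y) * (X c \<bullet> X c)"
      using Cauchy_Schwarz_ineq[of "rot ?y" "X c"] by (simp add: inner_rot_rot)
    then have "(bump p)\<^sup>2 * ((rot ?y \<bullet> X c)\<^sup>2 / r\<^sup>2) \<le> (bump p)\<^sup>2 * ((?y \<bullet> ?y) * (X c \<bullet> X c) / r\<^sup>2)"
      by (intro mult_left_mono divide_right_mono) auto
    then show ?thesis using True
      by (simp add: ring_form_def inner_weight_def bump_def extend_by_zero_def power_mult_distrib power_divide)
  next
    case False
    then show ?thesis by (simp add: ring_form_def bump_def extend_by_zero_def inner_weight_nonneg)
  qed
  moreover have "0 \<le> (1 - bump p) * background p X X"
    by (simp add: bump_bounds background_nonneg)
  ultimately show ?thesis by (simp add: ring_metric_def)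
qed

abbreviation L :: "'a \<Rightarrow> 'a tvec \<Rightarrow> real" where
  "L \<equiv> magnetic_lagrangian ring_metric ring_form"

lemma lagrangian_eq: "L p X = 1/2 * ring_metric p X X + ring_form p X"
  by (simp add: magnetic_lagrangian_def metric_norm_def ring_metric_nonneg)

lemma energy_eq: "energy ring_metric p X = 1/2 * ring_metric p X X"
  by (simp add: energy_def metric_norm_def ring_metric_nonneg)

text \<open>Completing the square, \<open>\<bar>X\<bar>\<^sup>2 / 2 + \<theta>(X) + 1/2 \<ge> (\<theta>(X) + 1)\<^sup>2 / 2\<close> as soon as \<open>\<theta>(X)\<^sup>2 \<le> \<bar>X\<bar>\<^sup>2\<close>.\<close>
lemma lagrangian_lower_bound: "L p X + 1/2 \<ge> 0"
proof -
  have "0 \<le> (ring_form p X + 1)\<^sup>2" by simp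
  also have "\<dots> \<le> ring_metric p X X + 2 * ring_form p X + 1"
    using ring_form_sq_le[of p X] by (simp add: power2_sum)
  finally show ?thesis by (simp add: lagrangian_eq)
qed

lemma fiber_deriv_lagrangian: "fiber_deriv L p X Y = ring_metric p X Y + ring_form p Y"
proof -
  have "L p (tv_comb X s Y) = 1/2 * (ring_metric p X X + 2 * s * ring_metric p X Y + s\<^sup>2 * ring_metric p Y Y)
      + ring_form p X + s * ring_form p Y" for s
  proof -
    have "ring_metric p (tv_comb X s Y) (tv_comb X s Y) =
        ring_metric p X X + 2 * s * ring_metric p X Y + s\<^sup>2 * ring_metric p Y Y"
      using ring_metric_sym[of p "tv_comb X s Y"] ring_metric_sym[of p Y X]
      by (simp add: ring_metric_comb power2_eq_square algebra_simps)
    then show ?thesis by (simp add: lagrangian_eq ring_form_comb)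
  qed
  then have eq: "(\<lambda>s. L p (tv_comb X s Y)) = (\<lambda>s. 1/2 * (ring_metric p X X + 2 * s * ring_metric p X Y + s\<^sup>2 * ring_metric p Y Y)
      + ring_form p X + s * ring_form p Y)" by blast
  show ?thesis
    unfolding fiber_deriv_def eq by (rule DERIV_imp_deriv) (auto intro!: derivative_eq_intros)
qed

end

section \<open>The circle and the critical value\<close>

text \<open>A curve drawn in the image of one chart. In any other chart \<open>d\<close> its expression is the transition map
  composed with \<open>\<xi>\<close>, so the chain rule computes its velocity.\<close>
lemma C1_curve_chart_inv:
  assumes A: "smooth_atlas S A" "c \<in> A"
    and \<xi>: "\<And>t. (\<xi> has_vector_derivative \<xi>' t) (at t)" "continuous_on UNIV \<xi>'"
      "\<And>t. \<xi> t \<in> snd c ` fst c"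
    and "a < b"
  shows "C1_curve S A a b (chart_inv c \<circ> \<xi>)"
    and "t \<in> {a..b} \<Longrightarrow> velocity A {a..b} (chart_inv c \<circ> \<xi>) t c = \<xi>' t"
proof -
  note c = atlas_chart[OF A]
  let ?\<gamma> = "chart_inv c \<circ> \<xi>"
  have cont: "continuous_on I \<xi>" for I
    using \<xi>(1) by (intro continuous_at_imp_continuous_on ballI has_vector_derivative_continuous)
  have in_c: "?\<gamma> t \<in> fst c" for t
    using chart_inv_in[OF \<xi>(3)] by simp
  have in_overlap: "\<xi> t \<in> snd c ` (fst c \<inter> fst d) \<longleftrightarrow> ?\<gamma> t \<in> fst d" for t and d :: "'a chart"
    using chart_image_Int[OF c, of "fst d"] \<xi>(3) by simp
  define D where "D d s = frechet_derivative (transition c d) (at (\<xi> s)) (\<xi>' s)" for d s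
  have deriv: "(snd d \<circ> ?\<gamma> has_vector_derivative D d t) (at t)" if "d \<in> A" "?\<gamma> t \<in> fst d" for d t
  proof -
    have "snd d \<circ> ?\<gamma> = transition c d \<circ> \<xi>" by (simp add: transition_def comp_assoc)
    moreover have "(transition c d has_derivative frechet_derivative (transition c d) (at (\<xi> t))) (at (\<xi> t))"
      using transition_has_derivative[OF A that(1) in_c[of t] that(2)] chart_chart_inv[OF \<xi>(3)] by simp
    ultimately show ?thesis
      unfolding D_def using vector_derivative_diff_chain_within[OF \<xi>(1), of "transition c d"]
      by (metis has_derivative_at_withinI)
  qed
  have vd: "vector_derivative (snd d \<circ> ?\<gamma>) (at t within {a..b}) = D d t"
    if "d \<in> A" "?\<gamma> t \<in> fst d" "t \<in> {a..b}" for d t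
    using vector_derivative_within_cbox[OF \<open>a < b\<close>, of t "snd d \<circ> ?\<gamma>" "D d t"] that(3)
      has_vector_derivative_at_within[OF deriv[OF that(1,2)]] by simp
  show "velocity A {a..b} ?\<gamma> t c = \<xi>' t" if "t \<in> {a..b}"
  proof -
    have "((\<lambda>x. x) has_derivative (\<lambda>x. x)) (at (\<xi> t))" by (rule has_derivative_ident)
    then have "(transition c c has_derivative (\<lambda>x. x)) (at (\<xi> t))"
      by (rule has_derivative_transform_within_open[where s = "snd c ` fst c"])
        (use c \<xi>(3) chart_chart_inv[of _ c] in \<open>auto simp: is_chart_def transition_def\<close>)
    then have "D c t = \<xi>' t" unfolding D_def using frechet_derivative_at by metis
    then show ?thesis using vd[OF A(2) in_c that] in_c A(2) by (simp add: velocity_def)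
  qed
  show "C1_curve S A a b ?\<gamma>"
    unfolding C1_curve_def
  proof (intro conjI ballI impI)
    show "continuous_on {a..b} ?\<gamma>"
      by (intro continuous_on_compose cont continuous_on_subset[OF continuous_on_chart_inv[OF c]])
        (use \<xi>(3) in auto)
    show "?\<gamma> ` {a..b} \<subseteq> S" using in_c chart_domain_subset[OF c] by blast
  next
    fix d t assume d: "d \<in> A" and t: "t \<in> {a..b}" "?\<gamma> t \<in> fst d"
    show "(snd d \<circ> ?\<gamma>) differentiable (at t within {a..b})"
      using deriv[OF d t(2)]
      by (meson differentiableI_vector has_vector_derivative_at_within)
    \<comment> \<open>Near \<open>t\<close> the curve stays in the domain of \<open>d\<close>, where the chain rule formula is continuous.\<close>
    define O' where "O' = \<xi> -` (snd c ` (fst c \<inter> fst d))"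
    have op: "open (snd c ` (fst c \<inter> fst d))"
      using open_chart_overlap[OF c atlas_chart[OF A(1) d]] .
    then have "open O'" unfolding O'_def using cont by (rule open_vimage)
    have "continuous_on O' (D d)"
    proof (rule continuous_on_eq)
      show "continuous_on O' (\<lambda>s. \<Sum>b\<in>Basis. (\<xi>' s \<bullet> b) *\<^sub>R frechet_derivative (transition c d) (at (\<xi> s)) b)"
      proof (intro continuous_intros)
        show "continuous_on O' \<xi>'" using \<xi>(2) continuous_on_subset by blast
        fix b
        show "continuous_on O' (\<lambda>s. frechet_derivative (transition c d) (at (\<xi> s)) b)"
          by (rule continuous_on_compose2[OF smooth_on_imp_continuous_on[OF
              smooth_on_frechet_derivative[OF smooth_transition[OF A d]]] cont])
            (auto simp: O'_def)
      qed
      fix s assume s: "s \<in> O'"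
      then have "transition c d differentiable (at (\<xi> s))"
        using smooth_on_differentiable[OF smooth_transition[OF A d]] by (simp add: O'_def)
      then interpret linear "frechet_derivative (transition c d) (at (\<xi> s))"
        by (rule linear_frechet_derivative)
      have "D d s = frechet_derivative (transition c d) (at (\<xi> s)) (\<Sum>b\<in>Basis. (\<xi>' s \<bullet> b) *\<^sub>R b)"
        by (simp add: D_def euclidean_representation)
      then show "(\<Sum>b\<in>Basis. (\<xi>' s \<bullet> b) *\<^sub>R frechet_derivative (transition c d) (at (\<xi> s)) b) = D d s"
        by (simp add: sum scaleR)
    qed
    moreover have tO: "t \<in> O'" using t in_overlap by (simp add: O'_def)
    ultimately have cD: "continuous (at t within {a..b}) (D d)"
      using \<open>open O'\<close> continuous_on_eq_continuous_at continuous_at_imp_continuous_at_within by blast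
    obtain e where e: "e > 0" "\<And>s. dist s t < e \<Longrightarrow> s \<in> O'"
      using \<open>open O'\<close> tO unfolding open_dist by blast
    show "continuous (at t within {a..b}) (\<lambda>s. vector_derivative (snd d \<circ> ?\<gamma>) (at s within {a..b}))"
      by (rule continuous_transform_within[OF cD e(1) t(1)])
        (use e(2) in_overlap vd[OF d] in \<open>auto simp: O'_def dist_commute\<close>)
  qed
qed

definition unit_vector :: "real \<Rightarrow> real^2" where
  "unit_vector s = cos s *\<^sub>R axis 1 1 + sin s *\<^sub>R axis 2 1"

lemma unit_vector_inner: "unit_vector s \<bullet> unit_vector s = 1"
  by (simp add: unit_vector_def inner_vec_def sum_2 axis_def flip: power2_eq_square)

lemma unit_vector_surj:
  assumes "norm y = 1"
  shows "\<exists>s. y = unit_vector s"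
proof -
  have "(y $ 1)\<^sup>2 + (y $ 2)\<^sup>2 = 1"
    using assms by (simp add: norm_eq_sqrt_inner inner_vec_def sum_2 power2_eq_square)
  then obtain s where "y $ 1 = cos s" "y $ 2 = sin s" by (rule sincos_total_2pi)
  then show ?thesis
    by (intro exI[of _ s]) (simp add: unit_vector_def vec_eq_iff forall_2 axis_def)
qed

lemma unit_vector_derivative: "(unit_vector has_vector_derivative rot (unit_vector s)) (at s)"
proof -
  have "rot (unit_vector s) = - sin s *\<^sub>R axis 1 1 + cos s *\<^sub>R axis 2 1"
    by (simp add: unit_vector_def rot_def vec_eq_iff forall_2 axis_def)
  then show ?thesis
    unfolding unit_vector_def[abs_def]
    by (auto intro!: derivative_eq_intros)
qed

context ring_lagrangian
begin

text \<open>The circle is traversed clockwise at unit speed, against the one-form, so that \<open>ring_form\<close> takes the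
  value \<open>- 1\<close> on the velocity and the action is as small as possible. The phase \<open>a\<close> places the point at
  time \<open>0\<close>.\<close>
definition circle_coord :: "real \<Rightarrow> real \<Rightarrow> real^2" where
  "circle_coord a t = x0 + r *\<^sub>R unit_vector (a - t / r)"

definition circle_curve :: "real \<Rightarrow> real \<Rightarrow> 'a" where
  "circle_curve a = chart_inv c \<circ> circle_coord a"

lemma circle_coord_derivative:
  "(circle_coord a has_vector_derivative - rot (unit_vector (a - t / r))) (at t)"
proof -
  have "((\<lambda>t. a - t / r) has_real_derivative - (1 / r)) (at t)"
    using r_pos by (auto intro!: derivative_eq_intros)
  from vector_diff_chain_at[OF this[unfolded has_real_derivative_iff_has_vector_derivative] unit_vector_derivative]
  have "((\<lambda>t. unit_vector (a - t / r)) has_vector_derivative (- (1 / r)) *\<^sub>R rot (unit_vector (a - t / r))) (at t)"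
    by (simp add: o_def)
  from has_vector_derivative_add[OF has_vector_derivative_const[of x0]
      bounded_linear.has_vector_derivative[OF bounded_linear_scaleR_right[of r] this]]
  show ?thesis
    unfolding circle_coord_def[abs_def] using r_pos by simp
qed

lemma circle_coord_sphere: "circle_coord a t \<in> sphere x0 r"
  using r_pos unit_vector_inner[of "a - t / r"]
  by (simp add: circle_coord_def dist_norm norm_eq_sqrt_inner)

lemma sphere_subset: "sphere x0 r \<subseteq> snd c ` fst c"
  using cball_subset r_pos by (force simp: subset_iff)

lemma circle_curve_C1: 
  assumes "s < t"
  shows "C1_curve S A s t (circle_curve a)"
    and "u \<in> {s..t} \<Longrightarrow> velocity A {s..t} (circle_curve a) u c = - rot (unit_vector (a - u / r))"
proof -
  have "continuous_on UNIV (\<lambda>t. - rot (unit_vector (a - t / r)))"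
    unfolding unit_vector_def
    by (intro continuous_intros bounded_linear.continuous_on[OF bounded_linear_rot]) (use r_pos in auto)
  note * = C1_curve_chart_inv[OF atlas c_in_A circle_coord_derivative[of a] this _ assms,
      folded circle_curve_def]
  show "C1_curve S A s t (circle_curve a)"
    using circle_coord_sphere sphere_subset by (intro *(1)) blast
  show "u \<in> {s..t} \<Longrightarrow> velocity A {s..t} (circle_curve a) u c = - rot (unit_vector (a - u / r))"
    using circle_coord_sphere sphere_subset by (intro *(2)) blast
qed

lemma circle_curve_in: "circle_curve a t \<in> ring_circle"
  using circle_coord_sphere by (simp add: circle_curve_def ring_circle_def)

lemma circle_curve_coord: "snd c (circle_curve a t) = circle_coord a t"
  using circle_coord_sphere sphere_subset by (simp add: circle_curve_def chart_chart_inv subset_iff)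

lemma on_ring_circle:
  assumes "p \<in> ring_circle"
  shows "ring_metric p X Y = X c \<bullet> Y c" and "ring_form p X = rot (snd c p - x0) \<bullet> X c / r"
proof -
  have "bump p = 1" using bump_eq_1_iff on_circle[OF assms] by simp
  then show "ring_metric p X Y = X c \<bullet> Y c" "ring_form p X = rot (snd c p - x0) \<bullet> X c / r"
    by (auto simp: ring_metric_when_bump_1 ring_form_def)
qed

lemma ring_form_circle_tangent:
  assumes "X c = - rot (unit_vector (a - t / r))"
  shows "ring_form (circle_curve a t) X = - 1"
proof -
  have "rot (r *\<^sub>R unit_vector (a - t / r)) = r *\<^sub>R rot (unit_vector (a - t / r))"
    by (rule linear_cmul) (rule bounded_linear.linear[OF bounded_linear_rot])
  then show ?thesis
    using assms r_pos
    by (simp add: on_ring_circle[OF circle_curve_in] circle_curve_coord circle_coord_def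
        inner_rot_rot unit_vector_inner)
qed

text \<open>The loop shrinks to the centre through the disc inside the chart.\<close>
lemma contractible_circle: "contractible_loop S (2 * pi * r) (circle_curve 0)"
  unfolding contractible_loop_def
proof (intro conjI bexI)
  have per: "circle_coord 0 (2 * pi * r) = circle_coord 0 0"
    using r_pos by (simp add: circle_coord_def unit_vector_def)
  then show "circle_curve 0 0 = circle_curve 0 (2 * pi * r)" by (simp add: circle_curve_def)
  have "x0 \<in> cball x0 (2 * r)" using r_pos by simp
  then show "chart_inv c x0 \<in> S"
    using chart_inv_in[of x0 c] cball_subset chart_domain_subset[OF chart_c] by blast
  have "homotopic_loops (cball x0 r) (\<lambda>s. circle_coord 0 (2 * pi * r * s)) (\<lambda>_. x0)"
  proof (rule homotopic_loops_linear)
    have "isCont (circle_coord 0) t" for t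
      using circle_coord_derivative has_vector_derivative_continuous by blast
    then have "continuous_on {0..1} (\<lambda>s. circle_coord 0 (2 * pi * r * s))"
      by (intro continuous_on_compose2[OF continuous_at_imp_continuous_on, of UNIV "circle_coord 0"])
        (auto intro!: continuous_intros)
    then show "path (\<lambda>s. circle_coord 0 (2 * pi * r * s))" by (simp add: path_def)
    show "closed_segment (circle_coord 0 (2 * pi * r * t)) x0 \<subseteq> cball x0 r" for t
      using circle_coord_sphere[of 0 "2 * pi * r * t"] r_pos
      by (intro closed_segment_subset) auto
  qed (use per in \<open>auto simp: pathstart_def pathfinish_def path_def\<close>)
  then have "homotopic_loops S (chart_inv c \<circ> (\<lambda>s. circle_coord 0 (2 * pi * r * s))) (chart_inv c \<circ> (\<lambda>_. x0))"
  proof (rule homotopic_loops_continuous_image)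
    have sub: "cball x0 r \<subseteq> snd c ` fst c"
      using cball_subset r_pos subset_cball[of r "2 * r" x0] by auto
    show "continuous_on (cball x0 r) (chart_inv c)"
      using continuous_on_chart_inv[OF chart_c] sub continuous_on_subset by blast
    show "chart_inv c \<in> cball x0 r \<rightarrow> S"
      using sub chart_inv_in[of _ c] chart_domain_subset[OF chart_c] by blast
  qed
  then show "homotopic_loops S (\<lambda>s. circle_curve 0 (2 * pi * r * s)) (\<lambda>_. chart_inv c x0)"
    by (simp add: o_def circle_curve_def)
qed

text \<open>For \<open>k = 1/2\<close> every integrand is nonnegative. Along one turn of the clockwise circle the integrand is
  the constant \<open>1/2 - 1 + k\<close>, so no smaller \<open>k\<close> is admissible.\<close>
lemma mane_cu_eq: "mane_cu S A L = ereal (1/2)"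
  unfolding mane_cu_def
proof (rule antisym)
  have "integral {0..T} (\<lambda>t. L (\<gamma> t) (velocity A {0..T} \<gamma> t) + 1/2) \<ge> 0" for T \<gamma>
  \<comment> \<open>A function that is not integrable has integral \<open>0\<close> by convention.\<close>
  proof (cases "(\<lambda>t. L (\<gamma> t) (velocity A {0..T} \<gamma> t) + 1/2) integrable_on {0..T}")
    case True
    then show ?thesis by (rule integral_nonneg) (rule lagrangian_lower_bound)
  next
    case False
    then show ?thesis by (simp add: not_integrable_integral)
  qed
  then show "Inf {ereal k | k. \<forall>T \<gamma>. T > 0 \<and> piecewise_C1_curve S A 0 T \<gamma> \<and> contractible_loop S T \<gamma> \<longrightarrow>
      integral {0..T} (\<lambda>t. L (\<gamma> t) (velocity A {0..T} \<gamma> t) + k) \<ge> 0} \<le> ereal (1/2)"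
    by (intro Inf_lower) blast
next
  show "ereal (1/2) \<le> Inf {ereal k | k. \<forall>T \<gamma>. T > 0 \<and> piecewise_C1_curve S A 0 T \<gamma> \<and> contractible_loop S T \<gamma> \<longrightarrow>
      integral {0..T} (\<lambda>t. L (\<gamma> t) (velocity A {0..T} \<gamma> t) + k) \<ge> 0}"
  proof (rule Inf_greatest)
    let ?T = "2 * pi * r" and ?\<gamma> = "circle_curve 0"
    fix z assume "z \<in> {ereal k | k. \<forall>T \<gamma>. T > 0 \<and> piecewise_C1_curve S A 0 T \<gamma> \<and> contractible_loop S T \<gamma> \<longrightarrow>
      integral {0..T} (\<lambda>t. L (\<gamma> t) (velocity A {0..T} \<gamma> t) + k) \<ge> 0}"
    then obtain k where z: "z = ereal k" and
      *: "\<And>T \<gamma>. T > 0 \<and> piecewise_C1_curve S A 0 T \<gamma> \<and> contractible_loop S T \<gamma> \<Longrightarrow>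
        0 \<le> integral {0..T} (\<lambda>t. L (\<gamma> t) (velocity A {0..T} \<gamma> t) + k)"
      by blast
    have T: "?T > 0" using r_pos by simp
    have "piecewise_C1_curve S A 0 ?T ?\<gamma>"
      unfolding piecewise_C1_curve_def
      using circle_curve_C1(1)[OF T] circle_curve_C1(1)
      by (auto simp: C1_curve_def[of S A 0] intro!: exI[of _ "{}"])
    then have "0 \<le> integral {0..?T} (\<lambda>t. L (?\<gamma> t) (velocity A {0..?T} ?\<gamma> t) + k)"
      using * T contractible_circle by blast
    also have "\<dots> = integral {0..?T} (\<lambda>t. k - 1/2)"
    proof (rule integral_cong)
      fix t assume "t \<in> {0..?T}"
      then have v: "velocity A {0..?T} ?\<gamma> t c = - rot (unit_vector (0 - t / r))"
        by (rule circle_curve_C1(2)[OF T])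
      from v have "ring_metric (?\<gamma> t) (velocity A {0..?T} ?\<gamma> t) (velocity A {0..?T} ?\<gamma> t) = 1"
        by (simp add: on_ring_circle[OF circle_curve_in] inner_rot_rot unit_vector_inner)
      then show "L (?\<gamma> t) (velocity A {0..?T} ?\<gamma> t) + k = k - 1/2"
        using ring_form_circle_tangent[of "velocity A {0..?T} ?\<gamma> t" 0 t, OF v] by (simp add: lagrangian_eq)
    qed
    also have "\<dots> = ?T * (k - 1/2)" using T by simp
    finally have "1/2 \<le> k" using T by (simp add: zero_le_mult_iff)
    then show "ereal (1/2) \<le> z" by (simp add: z)
  qed
qed

section \<open>The conormal condition on the circle\<close>

lemma ring_circle_tangent:
  assumes "p \<in> ring_circle"
  shows "\<exists>Y\<in>tangent_to S A ring_circle p. Y c \<bullet> Y c = 1 \<and> ring_form p Y = -1"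
proof -
  note p = on_circle[OF assms]
  have "norm ((1 / r) *\<^sub>R (snd c p - x0)) = 1"
    using p(2) r_pos by (simp add: dist_norm norm_minus_commute)
  then obtain a where "(1 / r) *\<^sub>R (snd c p - x0) = unit_vector a" using unit_vector_surj by blast
  then have "r *\<^sub>R unit_vector a = snd c p - x0" using r_pos by (auto simp flip: \<open>_ = unit_vector a\<close>)
  then have "circle_coord a 0 = snd c p" by (simp add: circle_coord_def)
  then have p0: "circle_curve a 0 = p" using chart_inv_chart[OF chart_c p(1)] by (simp add: circle_curve_def)
  define Y where "Y = velocity A {-1..1} (circle_curve a) 0"
  have Yc: "Y c = - rot (unit_vector (a - 0 / r))"
    unfolding Y_def by (rule circle_curve_C1(2)) auto
  have "Y \<in> tangent_to S A ring_circle p"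
    unfolding tangent_to_def Y_def using p0 circle_curve_in
    by (intro CollectI exI[of _ "circle_curve a"] exI[of _ 1]) (auto intro!: circle_curve_C1(1))
  moreover have "Y c \<bullet> Y c = 1" by (simp add: Yc inner_rot_rot unit_vector_inner)
  moreover have "ring_form p Y = -1" using ring_form_circle_tangent[of Y a 0, OF Yc] p0 by simp
  ultimately show ?thesis by blast
qed

text \<open>On the circle the metric is Euclidean and the one-form equals \<open>-1\<close> on a unit tangent vector \<open>Y\<close>. The
  conormal condition therefore forces \<open>\<langle>X, Y\<rangle> = 1\<close>, which a vector shorter than \<open>1\<close> cannot
  satisfy.\<close>
lemma conormal_imp_energy_ge:
  assumes p: "p \<in> ring_circle" and X: "\<forall>Y\<in>tangent_to S A ring_circle p. fiber_deriv L p X Y = 0"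
  shows "energy ring_metric p X \<ge> 1/2"
proof -
  obtain Y where Y: "Y \<in> tangent_to S A ring_circle p" "Y c \<bullet> Y c = 1" "ring_form p Y = -1"
    using ring_circle_tangent[OF p] by blast
  then have "X c \<bullet> Y c = 1"
    using X by (force simp: fiber_deriv_lagrangian on_ring_circle(1)[OF p])
  then have "1 \<le> X c \<bullet> X c"
    using Cauchy_Schwarz_ineq[of "X c" "Y c"] Y(2) by simp
  then show ?thesis by (simp add: energy_eq on_ring_circle(1)[OF p])
qed

end

section \<open>The circle as a submanifold\<close>

definition inversion :: "real^2 \<Rightarrow> real^2" where
  "inversion z = inverse (z \<bullet> z) *\<^sub>R z"

lemma inversion_inversion: "z \<noteq> 0 \<Longrightarrow> inversion (inversion z) = z"
  by (simp add: inversion_def field_simps)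

lemma inversion_eq_0_iff: "inversion z = 0 \<longleftrightarrow> z = 0"
  by (simp add: inversion_def)

lemma smooth_inversion: "smooth_on (- {0}) inversion"
proof -
  have "smooth_on (- {0::real^2}) (\<lambda>z. inverse (z \<bullet> z))"
    by (rule smooth_on_compose[OF smooth_on_inverse])
      (auto intro!: smooth_on_inner smooth_on_id open_Compl simp: Collect_neg_eq)
  then show ?thesis
    unfolding inversion_def[abs_def] by (intro smooth_on_scaleR smooth_on_id open_Compl) auto
qed

text \<open>A circle through the centre of the inversion corresponds to a line: \<open>z \<bullet> z = 2 z \<bullet> h\<close> becomes a linear
  equation after division by \<open>z \<bullet> z\<close>.\<close>
lemma inversion_sphere:
  assumes "z \<noteq> 0"
  shows "norm (z - h) = norm h \<longleftrightarrow> inversion z \<bullet> h = 1 / 2"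
proof -
  have "norm (z - h) = norm h \<longleftrightarrow> z \<bullet> z = 2 * (z \<bullet> h)"
    by (simp add: norm_eq inner_diff inner_commute)
  also have "\<dots> \<longleftrightarrow> inversion z \<bullet> h = 1 / 2"
    using assms by (auto simp: inversion_def field_simps)
  finally show ?thesis .
qed

context ring_lagrangian
begin

text \<open>An inversion centred at the antipode \<open>a\<close> of \<open>p\<close> on the circle maps the circle without \<open>a\<close> to a
  straight line. Subtracting the foot point \<open>m\<close> of the perpendicular from the origin moves the line to
  a linear subspace. Inversion is its own inverse, so the chart is a diffeomorphism onto its image.\<close>
lemma ring_circle_slice_chart:
  assumes "p \<in> ring_circle"
  shows "\<exists>e V. smooth_atlas S (insert e A) \<and> p \<in> fst e \<and> subspace V \<and> dim V = 1 \<and>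
    snd e ` (ring_circle \<inter> fst e) = snd e ` fst e \<inter> V"
proof -
  note p = on_circle[OF assms]
  define h where "h = snd c p - x0"
  define a where "a = x0 - h"
  define m where "m = inverse (2 * (h \<bullet> h)) *\<^sub>R h"
  have h: "h \<noteq> 0" "norm h = r" using p(2) r_pos by (auto simp: h_def dist_norm norm_minus_commute)
  define U where "U = snd c ` fst c - {a}"
  define \<Phi> where "\<Phi> x = inversion (x - a) - m" for x
  define \<Psi> where "\<Psi> w = a + inversion (w + m)" for w
  define e where "e = (chart_inv c ` U, \<Phi> \<circ> snd c)"
  define V where "V = {w. h \<bullet> w = 0}"
  have U: "open U" "U \<subseteq> snd c ` fst c"
    using chart_c by (auto simp: U_def is_chart_def)
  have \<Psi>\<Phi>: "\<Psi> (\<Phi> x) = x" if "x \<in> U" for x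
    using that by (simp add: \<Psi>_def \<Phi>_def U_def inversion_inversion)
  have smooth_\<Phi>: "smooth_on U \<Phi>"
    unfolding \<Phi>_def[abs_def]
    by (intro smooth_on_diff smooth_on_const U(1) smooth_on_compose[OF smooth_inversion] smooth_on_id open_Compl)
      (auto simp: U_def)
  have smooth_\<Psi>: "smooth_on (- {- m}) \<Psi>"
    unfolding \<Psi>_def[abs_def]
    by (intro smooth_on_add smooth_on_const smooth_on_compose[OF smooth_inversion] smooth_on_id open_Compl)
      (auto simp: eq_neg_iff_add_eq_0)
  have img: "\<Phi> ` U = (- {- m}) \<inter> \<Psi> -` U"
  proof (intro set_eqI iffI)
    fix w assume "w \<in> \<Phi> ` U"
    then show "w \<in> (- {- m}) \<inter> \<Psi> -` U"
      using \<Psi>\<Phi> by (auto simp: \<Phi>_def U_def inversion_eq_0_iff)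
  next
    fix w assume w: "w \<in> (- {- m}) \<inter> \<Psi> -` U"
    then have "w + m \<noteq> 0" by (auto simp: eq_neg_iff_add_eq_0)
    then have "w = \<Phi> (\<Psi> w)" by (simp add: \<Phi>_def \<Psi>_def inversion_inversion)
    then show "w \<in> \<Phi> ` U" using w by blast
  qed
  have "open (\<Phi> ` U)"
    unfolding img by (intro continuous_open_preimage smooth_on_imp_continuous_on[OF smooth_\<Psi>] U(1)) auto
  moreover have "smooth_on (\<Phi> ` U) \<Psi>"
    using smooth_\<Psi> by (rule smooth_on_subset) (simp add: img)
  ultimately have "smooth_atlas S (insert e A)"
    unfolding e_def by (rule smooth_atlas_insert_reparam[OF atlas c_in_A U smooth_\<Phi> _ _ \<Psi>\<Phi>])
  moreover have "p \<in> fst e"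
  proof -
    have "snd c p - a = 2 *\<^sub>R h" by (simp add: a_def h_def scaleR_2)
    then have "snd c p \<in> U" using p(1) h(1) by (auto simp: U_def)
    then show ?thesis using chart_inv_chart[OF chart_c p(1)] unfolding e_def by (metis fst_conv image_eqI)
  qed
  moreover have "subspace V" unfolding V_def by (rule subspace_hyperplane)
  moreover have "dim V = 1" unfolding V_def using dim_hyperplane[OF h(1)] by simp
  moreover have "snd e ` (ring_circle \<inter> fst e) = snd e ` fst e \<inter> V"
  proof -
    have coord: "snd c (chart_inv c x) = x" if "x \<in> snd c ` fst c" for x
      using that by (rule chart_chart_inv)
    have "inj_on (chart_inv c) (snd c ` fst c)"
      using coord by (rule inj_on_inverseI)
    then have "ring_circle \<inter> fst e = chart_inv c ` (sphere x0 r \<inter> U)"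
      using sphere_subset U(2) by (simp add: ring_circle_def e_def inj_on_image_Int)
    moreover have "snd e ` chart_inv c ` W = \<Phi> ` W" if "W \<subseteq> U" for W
    proof -
      have "snd e (chart_inv c x) = \<Phi> x" if "x \<in> W" for x
        using that \<open>W \<subseteq> U\<close> U(2) by (auto simp: e_def coord)
      then show ?thesis by (simp add: image_image)
    qed
    moreover have "x \<in> sphere x0 r \<longleftrightarrow> \<Phi> x \<in> V" if "x \<in> U" for x
    proof -
      have "x \<in> sphere x0 r \<longleftrightarrow> norm ((x - a) - h) = norm h"
        using h(2) by (simp add: a_def dist_norm norm_minus_commute)
      also have "\<dots> \<longleftrightarrow> inversion (x - a) \<bullet> h = 1 / 2"
        using that by (intro inversion_sphere) (simp add: U_def)
      also have "\<dots> \<longleftrightarrow> \<Phi> x \<in> V"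
        using h(1) by (auto simp: V_def \<Phi>_def m_def inner_diff_right inner_commute field_simps)
      finally show ?thesis .
    qed
    then have "\<Phi> ` (sphere x0 r \<inter> U) = \<Phi> ` U \<inter> V" by blast
    ultimately show ?thesis by (simp add: e_def)
  qed
  ultimately show ?thesis by blast
qed

lemma ring_circle_submanifold: "closed_connected_submanifold S A ring_circle"
  unfolding closed_connected_submanifold_def
proof (intro conjI exI[of _ 1] ballI ring_circle_slice_chart)
  show "ring_circle \<subseteq> S" using on_circle(1) chart_domain_subset[OF chart_c] by blast
  show "ring_circle \<noteq> {}" using circle_curve_in by blast
  have cont: "continuous_on (sphere x0 r) (chart_inv c)"
    using continuous_on_chart_inv[OF chart_c] sphere_subset continuous_on_subset by blast
  show "compact ring_circle"
    unfolding ring_circle_def by (intro compact_continuous_image cont) simp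
  show "connected ring_circle"
    unfolding ring_circle_def by (intro connected_continuous_image cont connected_sphere) simp
qed

end

section \<open>Conclusion\<close>

theorem proposition4p3p4:
  fixes S :: "'a::t2_space set" and A :: "'a chart set" and \<epsilon> :: real
  assumes "closed_connected_surface S A" and "orientable S A" and "\<epsilon> > 0"
  shows "\<exists>g \<theta> Q0 Q1.
    riemannian_metric S A g \<and> one_form S A \<theta> \<and>
    mane_cu S A (magnetic_lagrangian g \<theta>) \<in> {ereal (1/2 - \<epsilon>)..ereal (1/2)} \<and>
    closed_connected_submanifold S A Q0 \<and> closed_connected_submanifold S A Q1 \<and>
    Q0 \<inter> Q1 \<noteq> {} \<and>
    (\<forall>k < 1/2 - \<epsilon>. \<not> (\<exists>T \<gamma>.
       conormal_orbit S A (magnetic_lagrangian g \<theta>) (energy g) Q0 Q1 k T \<gamma>))"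
proof -
  have atlas: "smooth_atlas S A" and "compact S" and "S \<noteq> {}"
    using assms(1) by (simp_all add: closed_connected_surface_def)
  have S: "S = (\<Union>c\<in>A. fst c)" using atlas by (simp only: smooth_atlas_def)
  obtain p c where c: "c \<in> A" "p \<in> fst c" using \<open>S \<noteq> {}\<close> S by blast
  then have "open (snd c ` fst c)" using atlas_chart[OF atlas] by (simp add: is_chart_def)
  then obtain \<rho> where \<rho>: "\<rho> > 0" "cball (snd c p) \<rho> \<subseteq> snd c ` fst c"
    using c(2) open_contains_cball[of "snd c ` fst c"] by blast
  obtain J where "finite J"
    "\<forall>(d, \<kappa>)\<in>J. d \<in> A \<and> chart_cutoff d \<kappa> \<and> (\<forall>x. \<kappa> x \<ge> 0)"
    "\<forall>q\<in>S. \<exists>(d, \<kappa>)\<in>J. q \<in> fst d \<and> extend_by_zero d \<kappa> q > 0"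
    using exists_cutoff_family[OF atlas \<open>compact S\<close>] by blast
  then interpret ring_lagrangian S A J c "snd c p" "\<rho> / 2"
    by unfold_locales (use atlas c(1) \<rho> in auto)
  have no_orbit: "\<not> conormal_orbit S A L (energy ring_metric) ring_circle ring_circle k T \<gamma>"
    if "k < 1/2 - \<epsilon>" for k T \<gamma>
  proof
    assume orbit: "conormal_orbit S A L (energy ring_metric) ring_circle ring_circle k T \<gamma>"
    then have "0 \<in> {0..T}" by (simp add: conormal_orbit_def)
    with orbit have "energy ring_metric (\<gamma> 0) (velocity A {0..T} \<gamma> 0) = k"
      unfolding conormal_orbit_def by blast
    moreover have "energy ring_metric (\<gamma> 0) (velocity A {0..T} \<gamma> 0) \<ge> 1/2"
      using orbit by (intro conormal_imp_energy_ge) (simp_all add: conormal_orbit_def)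
    ultimately show False using that \<open>\<epsilon> > 0\<close> by simp
  qed
  show ?thesis
    by (intro exI[of _ ring_metric] exI[of _ ring_form] exI[of _ ring_circle] conjI)
      (use riemannian_ring_metric one_form_ring_form ring_circle_submanifold no_orbit \<open>\<epsilon> > 0\<close>
        ring_circle_submanifold[unfolded closed_connected_submanifold_def] in \<open>auto simp: mane_cu_eq\<close>)
qed

end
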